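(* Let $L$ be a minimal $Q$-graded subalgebra of a finite-dimensional semisimple Lie algebra $\mathbb{L}$ over $\mathbb{F}$. Then every almost inner derivation of $L$ is inner: $AID(L)=Inn(L)$.
   Context: $\mathbb{F}$ is an algebraically closed field of characteristic $0$; $\mathbb{L}$ is a finite-dimensional semisimple Lie algebra over $\mathbb{F}$; $H$ is a fixed maximal torus, $\Phi\subset H^*$ the corresponding root system, and $\mathbb{L}=H\oplus\bigoplus_{\alpha\in\Phi}L_\alpha$ the root space decomposition. Put $Q=\mathbb{Z}\Phi$. Definition. A subalgebra $L$ of $\mathbb{L}$ containing $H$ has the form $L=H\oplus\bigoplus_{\alpha\in\Psi}L_\alpha$ with $\Psi\subseteq\Phi$. It is called a $Q$-graded subalgebra if $Q=\mathrm{span}_{\mathbb{Z}}\Psi$. A $Q$-graded subalgebra $L$ is called minimal if there is no $Q$-graded subalgebra $L_1$ of $\mathbb{L}$ with $L_1\subsetneq L$. A derivation $D$ of a Lie algebra $L$ is almost inner if $D(x)\in[x,L]$ for all $x\in L$, where $[x,L]=\{[x,y]:y\in L\}$. $AID(L)$ is the space of almost inner derivations and $Inn(L)$ the space of inner derivations of $L$. *)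

theory Defs
  imports
    "HOL-Computational_Algebra.Polynomial"
    "HOL-Library.Function_Algebras"
begin

text \<open>
  Maps defined only on a subspace are represented by total functions vanishing outside it.
  Thus equality of functions is equality of maps on the subspace, and addition and integer
  multiples of such maps are the pointwise ones.
\<close>

definition linear_maps_on ::
    "('k::field \<Rightarrow> 'v::ab_group_add \<Rightarrow> 'v) \<Rightarrow> ('k \<Rightarrow> 'w::ab_group_add \<Rightarrow> 'w) \<Rightarrow>
      'v set \<Rightarrow> 'w set \<Rightarrow> ('v \<Rightarrow> 'w) set"
  where "linear_maps_on s1 s2 V W =
    {f. (\<forall>x\<in>V. f x \<in> W) \<and>
        (\<forall>x\<in>V. \<forall>y\<in>V. f (x + y) = f x + f y) \<and>
        (\<forall>c. \<forall>x\<in>V. f (s1 c x) = s2 c (f x)) \<and>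
        (\<forall>x. x \<notin> V \<longrightarrow> f x = 0)}"

definition int_span :: "('v \<Rightarrow> 'k::field) set \<Rightarrow> ('v \<Rightarrow> 'k) set"
  where "int_span = module.span (\<lambda>(n::int) f x. of_int n * f x)"

locale lie_algebra = vector_space scale
  for scale :: "'k::field \<Rightarrow> 'l::ab_group_add \<Rightarrow> 'l" (infixr \<open>*s\<close> 75) +
  fixes bracket :: "'l \<Rightarrow> 'l \<Rightarrow> 'l" (\<open>[_,/ _]\<^sub>L\<close>)
  assumes bracket_add_left: "[x + y, z]\<^sub>L = [x, z]\<^sub>L + [y, z]\<^sub>L"
    and bracket_add_right: "[x, y + z]\<^sub>L = [x, y]\<^sub>L + [x, z]\<^sub>L"
    and bracket_scale_left: "[c *s x, y]\<^sub>L = c *s [x, y]\<^sub>L"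
    and bracket_scale_right: "[x, c *s y]\<^sub>L = c *s [x, y]\<^sub>L"
    and bracket_self: "[x, x]\<^sub>L = 0"
    and jacobi: "[x, [y, z]\<^sub>L]\<^sub>L + [y, [z, x]\<^sub>L]\<^sub>L + [z, [x, y]\<^sub>L]\<^sub>L = 0"
begin

definition subalgebra :: "'l set \<Rightarrow> bool"
  where "subalgebra S \<longleftrightarrow> subspace S \<and> (\<forall>x\<in>S. \<forall>y\<in>S. [x, y]\<^sub>L \<in> S)"

definition lie_ideal :: "'l set \<Rightarrow> bool"
  where "lie_ideal I \<longleftrightarrow> subspace I \<and> (\<forall>x. \<forall>y\<in>I. [x, y]\<^sub>L \<in> I)"

primrec derived_series :: "'l set \<Rightarrow> nat \<Rightarrow> 'l set"
  where
    "derived_series S 0 = S"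
  | "derived_series S (Suc n) =
       span {[x, y]\<^sub>L | x y. x \<in> derived_series S n \<and> y \<in> derived_series S n}"

definition solvable :: "'l set \<Rightarrow> bool"
  where "solvable S \<longleftrightarrow> (\<exists>n. derived_series S n = {0})"

definition semisimple :: bool
  where "semisimple \<longleftrightarrow> (\<forall>I. lie_ideal I \<and> solvable I \<longrightarrow> I = {0})"

text \<open>
  Over an algebraically closed field an endomorphism of a finite-dimensional space is semisimple
  iff it is diagonalizable, that is, iff its eigenvectors span the space.
\<close>

definition ad_semisimple :: "'l \<Rightarrow> bool"
  where "ad_semisimple x \<longleftrightarrow> span {v. \<exists>c. [x, v]\<^sub>L = c *s v} = UNIV"

text \<open>A torus is not required to be abelian; over an algebraically closed field this is automatic.\<close>

definition torus :: "'l set \<Rightarrow> bool"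
  where "torus T \<longleftrightarrow> subalgebra T \<and> (\<forall>x\<in>T. ad_semisimple x)"

definition maximal_torus :: "'l set \<Rightarrow> bool"
  where "maximal_torus H \<longleftrightarrow> torus H \<and> (\<forall>T. torus T \<and> H \<subseteq> T \<longrightarrow> T = H)"

definition dual_space :: "'l set \<Rightarrow> ('l \<Rightarrow> 'k) set"
  where "dual_space H = linear_maps_on scale (*) H UNIV"

definition root_space :: "'l set \<Rightarrow> ('l \<Rightarrow> 'k) \<Rightarrow> 'l set"
  where "root_space H \<alpha> = {x. \<forall>h\<in>H. [h, x]\<^sub>L = \<alpha> h *s x}"

definition roots :: "'l set \<Rightarrow> ('l \<Rightarrow> 'k) set"
  where "roots H = {\<alpha> \<in> dual_space H. \<alpha> \<noteq> 0 \<and> root_space H \<alpha> \<noteq> {0}}"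

definition root_lattice :: "'l set \<Rightarrow> ('l \<Rightarrow> 'k) set"
  where "root_lattice H = int_span (roots H)"

text \<open>
  The sum of \<open>H\<close> and the root spaces, written here as a span, is automatically direct when
  \<open>H\<close> is a maximal torus: the summands are simultaneous eigenspaces of \<open>H\<close> for distinct weights.
\<close>

definition Q_graded_subalgebra :: "'l set \<Rightarrow> 'l set \<Rightarrow> bool"
  where "Q_graded_subalgebra H L \<longleftrightarrow>
    subalgebra L \<and> H \<subseteq> L \<and>
    (\<exists>\<Psi>\<subseteq>roots H. L = span (H \<union> (\<Union>\<alpha>\<in>\<Psi>. root_space H \<alpha>)) \<and>
      root_lattice H = int_span \<Psi>)"

definition minimal_Q_graded_subalgebra :: "'l set \<Rightarrow> 'l set \<Rightarrow> bool"
  where "minimal_Q_graded_subalgebra H L \<longleftrightarrow>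
    Q_graded_subalgebra H L \<and> \<not> (\<exists>L1. Q_graded_subalgebra H L1 \<and> L1 \<subset> L)"

definition derivations :: "'l set \<Rightarrow> ('l \<Rightarrow> 'l) set"
  where "derivations L =
    {D \<in> linear_maps_on scale scale L L.
      \<forall>x\<in>L. \<forall>y\<in>L. D [x, y]\<^sub>L = [D x, y]\<^sub>L + [x, D y]\<^sub>L}"

definition AID :: "'l set \<Rightarrow> ('l \<Rightarrow> 'l) set"
  where "AID L = {D \<in> derivations L. \<forall>x\<in>L. D x \<in> {[x, y]\<^sub>L | y. y \<in> L}}"

definition Inn :: "'l set \<Rightarrow> ('l \<Rightarrow> 'l) set"
  where "Inn L = {\<lambda>x. if x \<in> L then [y, x]\<^sub>L else 0 | y. y \<in> L}"

end

locale finite_dimensional_lie_algebra =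
  lie_algebra scale bracket + finite_dimensional_vector_space scale Basis
  for scale :: "'k::field \<Rightarrow> 'l::ab_group_add \<Rightarrow> 'l"
    and bracket :: "'l \<Rightarrow> 'l \<Rightarrow> 'l"
    and Basis :: "'l set"

end

(*
  Let L = H + N with N the sum of the root spaces L_a, a in Psi. If some h = [e, f] with e in L_a
  and f in L_(-a) were nonzero, then a(h) would be nonzero, because a commutator commuting with
  its entries is nilpotent while h is semisimple; the roots of L that are nonnegative at h would
  then give a smaller Q-graded subalgebra. So in a minimal L the space N is a subalgebra, and by
  Engel's theorem a graded subalgebra of N that spans N modulo [N, N] is all of N. An almost inner
  derivation D can be changed by an inner one so that it kills H; then it acts by a scalar on every
  root space. Evaluating D at a sum of root vectors, one from each root space not contained in
  [N, N], yields a single element of H that corrects these scalars. The corrected derivation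
  vanishes on a graded subalgebra spanning N modulo [N, N], hence everywhere.
*)

theory Submission
  imports Defs
begin

text \<open>Once \<open>D\<close> kills \<open>H\<close>, a root vector x satisfies
  \<open>D x = [x, y]\<close>, where only the part of y in \<open>H\<close> can contribute, but that
  part depends on x. The obstacle is to find one element of \<open>H\<close> that serves all roots.
  A sum X of root vectors forces this: \<open>D X = [X, k + n]\<close> involves a single k in
  \<open>H\<close>, at the price of [X, n] with n in \<open>N\<close>, which mixes weights. Since
  [X, n] lies in [N, N], comparing weights modulo [N, N] still determines the scalar of a root
  vector outside [N, N], and such root spaces are the ones needed to generate \<open>N\<close>.
  Minimality keeps [N, N] inside \<open>N\<close>: a nonzero bracket of opposite root vectors would
  lie in \<open>H\<close>. For Engel's theorem, nilpotency is known at the start for root vectors,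
  because they shift eigenvalues of \<open>H\<close>, but not for sums of them. The induction
  therefore stays among \<open>H\<close>-stable subalgebras, where each enlargement can be made by a
  root vector.\<close>

subsection \<open>Brackets and weight vectors\<close>

context lie_algebra
begin

lemma bracket_zero_left [simp]: "[0, x]\<^sub>L = 0"
  using bracket_add_left[of 0 0 x] by simp

lemma bracket_zero_right [simp]: "[x, 0]\<^sub>L = 0"
  using bracket_add_right[of x 0 0] by simp

lemma bracket_minus_left: "[- x, y]\<^sub>L = - [x, y]\<^sub>L"
  using bracket_add_left[of x "- x" y] by (simp add: eq_neg_iff_add_eq_0 add.commute)

lemma bracket_minus_right: "[x, - y]\<^sub>L = - [x, y]\<^sub>L"
  using bracket_add_right[of x y "- y"] by (simp add: eq_neg_iff_add_eq_0 add.commute)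

lemma bracket_antisym: "[y, x]\<^sub>L = - [x, y]\<^sub>L"
proof -
  have "[y, x]\<^sub>L + [x, y]\<^sub>L = 0"
    using bracket_add_left[of y x "y + x"] bracket_add_right[of y y x] bracket_add_right[of x y x]
    by (simp add: bracket_self)
  then show ?thesis
    by (simp add: eq_neg_iff_add_eq_0)
qed

lemma bracket_leibniz: "[x, [y, z]\<^sub>L]\<^sub>L = [[x, y]\<^sub>L, z]\<^sub>L + [y, [x, z]\<^sub>L]\<^sub>L"
proof -
  have "[y, [z, x]\<^sub>L]\<^sub>L = - [y, [x, z]\<^sub>L]\<^sub>L"
    using bracket_antisym[of z x] by (simp add: bracket_minus_right)
  moreover have "[z, [x, y]\<^sub>L]\<^sub>L = - [[x, y]\<^sub>L, z]\<^sub>L"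
    by (rule bracket_antisym)
  ultimately show ?thesis
    using jacobi[of x y z] by (simp add: algebra_simps)
qed

lemma bracket_sum_right: "[x, sum f A]\<^sub>L = (\<Sum>a\<in>A. [x, f a]\<^sub>L)"
  by (induction A rule: infinite_finite_induct) (simp_all add: bracket_add_right)

lemma subspace_bracket_vimage_left:
  assumes "subspace U"
  shows "subspace {x. [x, y]\<^sub>L \<in> U}"
  using assms by (auto simp: subspace_def bracket_add_left bracket_scale_left)

lemma subspace_bracket_vimage_right:
  assumes "subspace U"
  shows "subspace {y. [x, y]\<^sub>L \<in> U}"
  using assms by (auto simp: subspace_def bracket_add_right bracket_scale_right)

lemma span_bracket_mem:
  assumes "subspace U" "\<And>x y. x \<in> A \<Longrightarrow> y \<in> B \<Longrightarrow> [x, y]\<^sub>L \<in> U" "x \<in> span A" "y \<in> span B"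
  shows "[x, y]\<^sub>L \<in> U"
proof -
  have "span B \<subseteq> {y. [x, y]\<^sub>L \<in> U}" if "x \<in> A" for x
    using assms that by (intro span_minimal subspace_bracket_vimage_right) auto
  then have "span A \<subseteq> {x. [x, y]\<^sub>L \<in> U}"
    using assms by (intro span_minimal subspace_bracket_vimage_left) auto
  then show ?thesis
    using assms by blast
qed

lemma subspace_root_space: "subspace (root_space H \<alpha>)"
  by (auto simp: subspace_def root_space_def bracket_add_right bracket_scale_right scale_right_distrib
      mult.commute)

lemma root_spaceD: "x \<in> root_space H \<alpha> \<Longrightarrow> h \<in> H \<Longrightarrow> [h, x]\<^sub>L = \<alpha> h *s x"
  by (simp add: root_space_def)

lemma root_space_bracket:
  assumes "x \<in> root_space H \<alpha>" "y \<in> root_space H \<beta>"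
  shows "[x, y]\<^sub>L \<in> root_space H (\<alpha> + \<beta>)"
  using assms unfolding root_space_def
  by (auto simp: bracket_leibniz bracket_scale_left bracket_scale_right scale_left_distrib)

text \<open>
  Weights are compared as functions on the whole space, so they are required to vanish outside
  the acting set.
\<close>

lemma weight_component_mem:
  assumes "finite A" "subspace U" "\<And>h u. h \<in> H \<Longrightarrow> u \<in> U \<Longrightarrow> [h, u]\<^sub>L \<in> U"
    and "\<And>\<alpha>. \<alpha> \<in> A \<Longrightarrow> v \<alpha> \<in> root_space H \<alpha>"
    and "\<And>\<alpha> h. \<alpha> \<in> A \<Longrightarrow> h \<notin> H \<Longrightarrow> \<alpha> h = 0"
    and "(\<Sum>\<alpha>\<in>A. v \<alpha>) \<in> U" "\<alpha> \<in> A"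
  shows "v \<alpha> \<in> U"
  using assms(1,4-)
proof (induction A arbitrary: v \<alpha> rule: finite_induct)
  case empty
  then show ?case by simp
next
  case (insert \<beta> A)
  let ?s = "v \<beta> + (\<Sum>\<alpha>\<in>A. v \<alpha>)"
  have s: "?s \<in> U"
    using insert by simp
  have A: "v \<gamma> \<in> U" if "\<gamma> \<in> A" for \<gamma>
  proof -
    have "\<gamma> \<noteq> \<beta>"
      using that insert by auto
    then obtain h where "\<gamma> h \<noteq> \<beta> h"
      by blast
    moreover have "h \<in> H"
      using calculation insert.prems(2)[of \<gamma> h] insert.prems(2)[of \<beta> h] that by force
    ultimately have h: "h \<in> H" "\<gamma> h - \<beta> h \<noteq> 0"
      by auto
    \<comment> \<open>\<open>ad h\<close> minus \<open>\<beta> h\<close> kills the component of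
      weight \<open>\<beta>\<close> and multiplies the one at \<open>\<gamma>\<close> by a nonzero
      scalar, so the induction hypothesis applies to the shorter sum.\<close>
    have "[h, ?s]\<^sub>L - \<beta> h *s ?s \<in> U"
      using assms(2,3) s h by (intro subspace_diff subspace_scale) auto
    also have "[h, ?s]\<^sub>L - \<beta> h *s ?s = (\<Sum>\<alpha>\<in>A. (\<alpha> h - \<beta> h) *s v \<alpha>)"
    proof -
      have "[h, v \<alpha>]\<^sub>L = \<alpha> h *s v \<alpha>" if "\<alpha> \<in> insert \<beta> A" for \<alpha>
        using that insert.prems(1) h root_spaceD by blast
      then show ?thesis
        by (simp add: bracket_add_right bracket_sum_right scale_sum_right
            sum_subtractf scale_left_diff_distrib scale_right_distrib)
    qed
    finally have "(\<gamma> h - \<beta> h) *s v \<gamma> \<in> U"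
      using insert.prems that
      by (intro insert.IH[of "\<lambda>\<alpha>. (\<alpha> h - \<beta> h) *s v \<alpha>"] subspace_scale[OF subspace_root_space]) auto
    then have "inverse (\<gamma> h - \<beta> h) *s (\<gamma> h - \<beta> h) *s v \<gamma> \<in> U"
      using assms(2) subspace_scale by blast
    then show ?thesis
      using h by simp
  qed
  show ?case
  proof (cases "\<alpha> = \<beta>")
    case True
    have "?s - (\<Sum>\<alpha>\<in>A. v \<alpha>) \<in> U"
      using A s assms(2) by (intro subspace_diff subspace_sum) auto
    then show ?thesis
      using True by simp
  next
    case False
    then show ?thesis
      using A insert.prems by auto
  qed
qed

lemma weight_sum_eq_0:
  assumes "finite A" "\<And>\<alpha>. \<alpha> \<in> A \<Longrightarrow> v \<alpha> \<in> root_space H \<alpha>"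
    and "\<And>\<alpha> h. \<alpha> \<in> A \<Longrightarrow> h \<notin> H \<Longrightarrow> \<alpha> h = 0"
    and "(\<Sum>\<alpha>\<in>A. v \<alpha>) = 0" "\<alpha> \<in> A"
  shows "v \<alpha> = 0"
  using weight_component_mem[of A "{0}" H v \<alpha>] assms by simp

lemma weight_sum_component:
  assumes "finite A" "\<And>\<alpha>. \<alpha> \<in> A \<Longrightarrow> v \<alpha> \<in> root_space H \<alpha>"
    and "\<And>\<alpha> h. \<alpha> \<in> insert \<beta> A \<Longrightarrow> h \<notin> H \<Longrightarrow> \<alpha> h = 0"
    and "(\<Sum>\<alpha>\<in>A. v \<alpha>) \<in> root_space H \<beta>"
  shows "(\<Sum>\<alpha>\<in>A. v \<alpha>) = (if \<beta> \<in> A then v \<beta> else 0)"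
proof -
  let ?s = "\<Sum>\<alpha>\<in>A. v \<alpha>"
  define w where "w \<alpha> = (if \<alpha> \<in> A then v \<alpha> else 0) - (if \<alpha> = \<beta> then ?s else 0)" for \<alpha>
  have "(\<Sum>\<alpha>\<in>insert \<beta> A. w \<alpha>) = (\<Sum>\<alpha>\<in>insert \<beta> A. if \<alpha> \<in> A then v \<alpha> else 0) - ?s"
    using assms(1) unfolding w_def by (subst sum_subtractf) simp
  also have "(\<Sum>\<alpha>\<in>insert \<beta> A. if \<alpha> \<in> A then v \<alpha> else 0) = ?s"
    using assms(1) by (intro sum.mono_neutral_cong_right) auto
  finally have "(\<Sum>\<alpha>\<in>insert \<beta> A. w \<alpha>) = 0"
    by simp
  moreover have "w \<alpha> \<in> root_space H \<alpha>" if "\<alpha> \<in> insert \<beta> A" for \<alpha>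
    using that assms subspace_root_space[of H \<alpha>] unfolding w_def
    by (intro subspace_diff) (auto simp: subspace_0)
  ultimately have "w \<beta> = 0"
    using assms by (intro weight_sum_eq_0[of "insert \<beta> A" w H]) auto
  then show ?thesis
    by (simp add: w_def)
qed

end

section \<open>Weights in finite dimension, diagonalizable elements and tori\<close>

context finite_dimensional_lie_algebra
begin

notation scale (infixr \<open>*s\<close> 75)
notation bracket (\<open>[_,/ _]\<^sub>L\<close>)

text \<open>Nonzero vectors of distinct weights are linearly independent. The acting set
  \<open>H\<close> is arbitrary; a singleton turns weights into eigenvalues of one
  \<open>ad h\<close>.\<close>

lemma finite_weights: "finite {\<alpha>. (\<forall>h. h \<notin> H \<longrightarrow> \<alpha> h = 0) \<and> root_space H \<alpha> \<noteq> {0}}"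
proof -
  define W where "W = {\<alpha>. (\<forall>h. h \<notin> H \<longrightarrow> \<alpha> h = 0) \<and> root_space H \<alpha> \<noteq> {0}}"
  have "\<forall>\<alpha>\<in>W. \<exists>v. v \<noteq> 0 \<and> v \<in> root_space H \<alpha>"
  proof
    fix \<alpha> assume "\<alpha> \<in> W"
    then show "\<exists>v. v \<noteq> 0 \<and> v \<in> root_space H \<alpha>"
      using subspace_0[OF subspace_root_space, of H \<alpha>] unfolding W_def by blast
  qed
  from bchoice[OF this] obtain v
    where v: "\<And>\<alpha>. \<alpha> \<in> W \<Longrightarrow> v \<alpha> \<noteq> 0" "\<And>\<alpha>. \<alpha> \<in> W \<Longrightarrow> v \<alpha> \<in> root_space H \<alpha>"
    by blast
  have inj: "inj_on v W"
  proof (rule inj_onI)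
    fix \<alpha> \<beta> assume *: "\<alpha> \<in> W" "\<beta> \<in> W" "v \<alpha> = v \<beta>"
    have "\<alpha> h = \<beta> h" for h
    proof (cases "h \<in> H")
      case True
      then have "\<alpha> h *s v \<alpha> = \<beta> h *s v \<alpha>"
        using root_spaceD[OF v(2)] * by metis
      then show ?thesis
        using v * by (simp add: scale_cancel_right)
    next
      case False
      then show ?thesis
        using * by (simp add: W_def)
    qed
    then show "\<alpha> = \<beta>"
      by blast
  qed
  have "independent (v ` W)"
  proof
    assume "dependent (v ` W)"
    then obtain t u where t: "finite t" "t \<subseteq> v ` W" "(\<Sum>x\<in>t. u x *s x) = 0" "\<exists>x\<in>t. u x \<noteq> 0"
      unfolding dependent_explicit by blast
    from t(2) obtain A where A: "A \<subseteq> W" "t = v ` A"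
      by (auto simp: subset_image_iff)
    have injA: "inj_on v A"
      using inj A by (auto intro: inj_on_subset)
    then have "finite A"
      using t A finite_imageD by blast
    have "(\<Sum>\<alpha>\<in>A. u (v \<alpha>) *s v \<alpha>) = 0"
      using t(3) A(2) injA by (simp add: sum.reindex)
    moreover have "u (v \<alpha>) *s v \<alpha> \<in> root_space H \<alpha>" if "\<alpha> \<in> A" for \<alpha>
    using that A(1) v(2) by (intro subspace_scale[OF subspace_root_space]) blast
  ultimately have "u (v \<alpha>) *s v \<alpha> = 0" if "\<alpha> \<in> A" for \<alpha>
    using \<open>finite A\<close> A(1) that
    by (intro weight_sum_eq_0[of A "\<lambda>\<alpha>. u (v \<alpha>) *s v \<alpha>" H]) (auto simp: W_def)
  then show False
      using t(4) A v(1) by auto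
  qed
  then have "finite (v ` W)"
    by (rule finiteI_independent)
  then show ?thesis
    using inj finite_imageD unfolding W_def by blast
qed

lemma finite_eigenvalues: "finite {c. \<exists>v. v \<noteq> 0 \<and> [h, v]\<^sub>L = c *s v}"
proof -
  let ?\<alpha> = "\<lambda>c x. if x = h then c else 0"
  have "{c. \<exists>v. v \<noteq> 0 \<and> [h, v]\<^sub>L = c *s v} \<subseteq>
      (\<lambda>\<alpha>. \<alpha> h) ` {\<alpha>. (\<forall>x. x \<notin> {h} \<longrightarrow> \<alpha> x = 0) \<and> root_space {h} \<alpha> \<noteq> {0}}"
  proof clarify
    fix c v assume "v \<noteq> 0" "[h, v]\<^sub>L = c *s v"
    then have "v \<in> root_space {h} (?\<alpha> c)" "v \<notin> {0}"
      by (auto simp: root_space_def)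
    then show "c \<in> (\<lambda>\<alpha>. \<alpha> h) ` {\<alpha>. (\<forall>x. x \<notin> {h} \<longrightarrow> \<alpha> x = 0) \<and> root_space {h} \<alpha> \<noteq> {0}}"
      by (intro image_eqI[of _ _ "?\<alpha> c"]) auto
  qed
  then show ?thesis
    using finite_weights[of "{h}"] finite_surj by blast
qed

lemma span_UN_subspaces:
  assumes "finite A" "\<And>a. a \<in> A \<Longrightarrow> subspace (S a)" "x \<in> span (\<Union>a\<in>A. S a)"
  obtains v where "\<And>a. a \<in> A \<Longrightarrow> v a \<in> S a" "x = (\<Sum>a\<in>A. v a)"
proof -
  let ?T = "{(\<Sum>a\<in>A. v a) | v. \<forall>a\<in>A. v a \<in> S a}"
  have "subspace ?T"
    unfolding subspace_def
  proof (intro conjI ballI allI)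
    show "0 \<in> ?T"
      using assms(2) by (auto intro!: exI[of _ "\<lambda>_. 0"] simp: subspace_0)
  next
    fix x y assume "x \<in> ?T" "y \<in> ?T"
    then obtain v w where "x = sum v A" "\<forall>a\<in>A. v a \<in> S a" "y = sum w A" "\<forall>a\<in>A. w a \<in> S a"
      by blast
    then show "x + y \<in> ?T"
      using assms(2) by (auto intro!: exI[of _ "\<lambda>a. v a + w a"] simp: subspace_add sum.distrib)
  next
    fix c x assume "x \<in> ?T"
    then obtain v where "x = sum v A" "\<forall>a\<in>A. v a \<in> S a"
      by blast
    then show "c *s x \<in> ?T"
      using assms(2)
      by (auto intro!: exI[of _ "\<lambda>a. c *s v a"] simp: subspace_scale scale_sum_right)
  qed
  moreover have "(\<Union>a\<in>A. S a) \<subseteq> ?T"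
  proof
    fix x assume "x \<in> (\<Union>a\<in>A. S a)"
    then obtain a where a: "a \<in> A" "x \<in> S a"
      by blast
    have "x = (\<Sum>b\<in>A. if b = a then x else 0)"
      using a assms(1) by simp
    then show "x \<in> ?T"
      using a assms(2) by (auto intro!: exI[of _ "\<lambda>b. if b = a then x else 0"] simp: subspace_0)
  qed
  ultimately have "x \<in> ?T"
    using assms(3) span_minimal by blast
  then show ?thesis
    using that by blast
qed

lemma ad_semisimple_decomposition:
  assumes "ad_semisimple x"
  obtains A w where "finite A" "\<And>\<alpha>. \<alpha> \<in> A \<Longrightarrow> w \<alpha> \<in> root_space {x} \<alpha>"
    "\<And>\<alpha> h. \<alpha> \<in> A \<Longrightarrow> h \<notin> {x} \<Longrightarrow> \<alpha> h = 0" "v = (\<Sum>\<alpha>\<in>A. w \<alpha>)"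
proof -
  define A where "A = {\<alpha>. (\<forall>h. h \<notin> {x} \<longrightarrow> \<alpha> h = 0) \<and> root_space {x} \<alpha> \<noteq> {0}}"
  have "{v. \<exists>c. [x, v]\<^sub>L = c *s v} \<subseteq> span (\<Union>\<alpha>\<in>A. root_space {x} \<alpha>)"
  proof clarify
    fix v c assume v: "[x, v]\<^sub>L = c *s v"
    show "v \<in> span (\<Union>\<alpha>\<in>A. root_space {x} \<alpha>)"
    proof (cases "v = 0")
      case False
      let ?\<alpha> = "\<lambda>z. if z = x then c else 0"
      have "v \<in> root_space {x} ?\<alpha>"
        using v by (simp add: root_space_def)
      moreover from this have "?\<alpha> \<in> A"
        using False unfolding A_def by auto
      ultimately show ?thesis
        by (intro span_base) blast
    qed (simp add: span_zero)
  qed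
  then have "span {v. \<exists>c. [x, v]\<^sub>L = c *s v} \<subseteq> span (\<Union>\<alpha>\<in>A. root_space {x} \<alpha>)"
    by (simp add: span_minimal)
  then have "v \<in> span (\<Union>\<alpha>\<in>A. root_space {x} \<alpha>)"
    using assms unfolding ad_semisimple_def by blast
  moreover have "finite A"
    unfolding A_def by (rule finite_weights)
  ultimately obtain w where "\<And>\<alpha>. \<alpha> \<in> A \<Longrightarrow> w \<alpha> \<in> root_space {x} \<alpha>" "v = (\<Sum>\<alpha>\<in>A. w \<alpha>)"
    using span_UN_subspaces[of A "root_space {x}" v] subspace_root_space by metis
  then show ?thesis
    using \<open>finite A\<close> by (intro that[of A w]) (auto simp: A_def)
qed

text \<open>A diagonalizable map has the same kernel as its square: on each eigencomponent, either
  the component vanishes or the square of its eigenvalue does, and then so does the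
  eigenvalue.\<close>

lemma ad_semisimple_kernel:
  assumes "ad_semisimple x" "[x, [x, v]\<^sub>L]\<^sub>L = 0"
  shows "[x, v]\<^sub>L = 0"
proof -
  obtain A w where A: "finite A" "\<And>\<alpha>. \<alpha> \<in> A \<Longrightarrow> w \<alpha> \<in> root_space {x} \<alpha>"
    "\<And>\<alpha> h. \<alpha> \<in> A \<Longrightarrow> h \<notin> {x} \<Longrightarrow> \<alpha> h = 0" "v = (\<Sum>\<alpha>\<in>A. w \<alpha>)"
    using ad_semisimple_decomposition[OF assms(1)] by metis
  have xw: "[x, w \<alpha>]\<^sub>L = \<alpha> x *s w \<alpha>" if "\<alpha> \<in> A" for \<alpha>
    using A(2)[OF that] by (simp add: root_space_def)
  have "(\<Sum>\<alpha>\<in>A. \<alpha> x *s \<alpha> x *s w \<alpha>) = [x, [x, v]\<^sub>L]\<^sub>L"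
    using xw by (simp add: A(4) bracket_sum_right bracket_scale_right)
  then have "\<alpha> x *s \<alpha> x *s w \<alpha> = 0" if "\<alpha> \<in> A" for \<alpha>
    using A that assms subspace_root_space
    by (intro weight_sum_eq_0[of A "\<lambda>\<alpha>. \<alpha> x *s \<alpha> x *s w \<alpha>" "{x}"]) (auto intro!: subspace_scale)
  then have "\<alpha> x *s w \<alpha> = 0" if "\<alpha> \<in> A" for \<alpha>
    using that by (cases "\<alpha> x = 0") auto
  then have "[x, w \<alpha>]\<^sub>L = 0" if "\<alpha> \<in> A" for \<alpha>
    using xw that by simp
  then show ?thesis
    by (simp add: A(4) bracket_sum_right)
qed

text \<open>The eigencomponents of \<open>y\<close> under \<open>ad x\<close> stay in
  \<open>T\<close>. For such a component w, \<open>[w, x]\<close> is a multiple of w, so applying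
  \<open>ad w\<close> twice kills \<open>x\<close>; since \<open>ad w\<close> is semisimple,
  applying it once already does.\<close>

lemma torus_abelian:
  assumes "torus T" "x \<in> T" "y \<in> T"
  shows "[x, y]\<^sub>L = 0"
proof -
  obtain A w where A: "finite A" "\<And>\<alpha>. \<alpha> \<in> A \<Longrightarrow> w \<alpha> \<in> root_space {x} \<alpha>"
    "\<And>\<alpha> h. \<alpha> \<in> A \<Longrightarrow> h \<notin> {x} \<Longrightarrow> \<alpha> h = 0" "y = (\<Sum>\<alpha>\<in>A. w \<alpha>)"
    using ad_semisimple_decomposition assms unfolding torus_def by metis
  have T: "w \<alpha> \<in> T" if "\<alpha> \<in> A" for \<alpha>
    using assms A that unfolding torus_def subalgebra_def
    by (intro weight_component_mem[of A T "{x}" w]) auto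
  have "[x, w \<alpha>]\<^sub>L = 0" if "\<alpha> \<in> A" for \<alpha>
  proof -
    have "[x, w \<alpha>]\<^sub>L = \<alpha> x *s w \<alpha>"
      using A(2)[OF that] by (simp add: root_space_def)
    then have "[w \<alpha>, [w \<alpha>, x]\<^sub>L]\<^sub>L = 0"
      by (simp add: bracket_antisym[of "w \<alpha>" x] bracket_minus_right bracket_scale_right bracket_self)
    then have "[w \<alpha>, x]\<^sub>L = 0"
      using ad_semisimple_kernel T that assms unfolding torus_def by blast
    then show ?thesis
      by (simp add: bracket_antisym[of x "w \<alpha>"])
  qed
  then show ?thesis
    by (simp add: A(4) bracket_sum_right)
qed

lemma funpow_bracket_0 [simp]: "(bracket e ^^ n) 0 = 0"
  by (induction n) auto

lemma funpow_bracket_add: "(bracket e ^^ n) (v + w) = (bracket e ^^ n) v + (bracket e ^^ n) w"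
  by (induction n) (auto simp: bracket_add_right)

lemma funpow_bracket_scale: "(bracket e ^^ n) (c *s v) = c *s (bracket e ^^ n) v"
  by (induction n) (auto simp: bracket_scale_right)

lemma funpow_bracket_eigenvector:
  assumes "[h, e]\<^sub>L = a *s e" "[h, v]\<^sub>L = c *s v"
  shows "[h, (bracket e ^^ n) v]\<^sub>L = (c + of_nat n * a) *s (bracket e ^^ n) v"
proof (induction n)
  case (Suc n)
  then show ?case
    by (simp add: bracket_leibniz[of h e] assms bracket_scale_left bracket_scale_right
        algebra_simps flip: scale_left_distrib)
qed (use assms in simp)

lemma funpow_bracket_mono:
  assumes "(bracket e ^^ n) v = 0" "n \<le> m"
  shows "(bracket e ^^ m) v = 0"
proof -
  have "(bracket e ^^ (m - n + n)) v = (bracket e ^^ (m - n)) ((bracket e ^^ n) v)"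
    by (simp only: funpow_add o_apply)
  then show ?thesis
    using assms by simp
qed

lemma subspace_ad_nilpotent: "subspace {v. \<exists>n. (bracket e ^^ n) v = 0}"
  unfolding subspace_def
proof (intro conjI ballI allI)
  fix x y assume "x \<in> {v. \<exists>n. (bracket e ^^ n) v = 0}" "y \<in> {v. \<exists>n. (bracket e ^^ n) v = 0}"
  then obtain n m where "(bracket e ^^ n) x = 0" "(bracket e ^^ m) y = 0"
    by blast
  then have "(bracket e ^^ (max n m)) (x + y) = 0"
    using funpow_bracket_mono by (simp add: funpow_bracket_add)
  then show "x + y \<in> {v. \<exists>n. (bracket e ^^ n) v = 0}"
    by blast
next
  fix c x assume "x \<in> {v. \<exists>n. (bracket e ^^ n) v = 0}"
  then show "c *s x \<in> {v. \<exists>n. (bracket e ^^ n) v = 0}"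
    by (auto simp: funpow_bracket_scale)
qed simp

end

subsection \<open>Nilpotency and strings of weights\<close>

locale lie_algebra_char_0 = finite_dimensional_lie_algebra scale bracket Basis
  for scale :: "'k::field_char_0 \<Rightarrow> 'l::ab_group_add \<Rightarrow> 'l"
    and bracket :: "'l \<Rightarrow> 'l \<Rightarrow> 'l"
    and Basis :: "'l set"
begin

text \<open>Each application of \<open>e\<close> shifts the eigenvalue of \<open>ad h\<close> by
  \<open>a\<close>. In characteristic 0 the shifted values are pairwise distinct, and only finitely
  many can be eigenvalues. The exponent may depend on \<open>v\<close>.\<close>

lemma ad_nilpotent:
  assumes "ad_semisimple h" "[h, e]\<^sub>L = a *s e" "a \<noteq> 0"
  shows "\<exists>n. (bracket e ^^ n) v = 0"
proof -
  have "{v. \<exists>c. [h, v]\<^sub>L = c *s v} \<subseteq> {v. \<exists>n. (bracket e ^^ n) v = 0}"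
  proof (clarify, rule ccontr)
    fix v c assume v: "[h, v]\<^sub>L = c *s v" "\<nexists>n. (bracket e ^^ n) v = 0"
    have "range (\<lambda>n. c + of_nat n * a) \<subseteq> {c. \<exists>v. v \<noteq> 0 \<and> [h, v]\<^sub>L = c *s v}"
      using funpow_bracket_eigenvector[OF assms(2) v(1)] v(2) by blast
    then have "finite (range (\<lambda>n. c + of_nat n * a))"
      using finite_eigenvalues finite_subset by blast
    moreover have "inj (\<lambda>n. c + of_nat n * a)"
      using assms(3) by (simp add: inj_def)
    ultimately show False
      using finite_imageD infinite_UNIV_nat by blast
  qed
  then have "span {v. \<exists>c. [h, v]\<^sub>L = c *s v} \<subseteq> {v. \<exists>n. (bracket e ^^ n) v = 0}"
    using span_minimal subspace_ad_nilpotent by blast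
  then show ?thesis
    using assms(1) unfolding ad_semisimple_def by blast
qed

text \<open>Commuting \<open>e\<close> past one factor \<open>f\<close> at a time leaves
  \<open>h\<close> acting on \<open>(bracket f ^^ i) w\<close> with eigenvalue
  \<open>\<mu> - i * a\<close>; the coefficient is the sum of these values for i = 0, ...,
  j.\<close>

lemma highest_weight_bracket:
  assumes "[e, f]\<^sub>L = h" "[h, f]\<^sub>L = - a *s f" "[e, w]\<^sub>L = 0" "[h, w]\<^sub>L = \<mu> *s w"
  shows "[e, (bracket f ^^ Suc j) w]\<^sub>L =
    (of_nat (Suc j) * (\<mu> - a * of_nat j / 2)) *s (bracket f ^^ j) w"
proof (induction j)
  case 0
  then show ?case
    using assms by (simp add: bracket_leibniz[of e f])
next
  case (Suc j)
  have "[e, (bracket f ^^ Suc (Suc j)) w]\<^sub>L =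
      [h, (bracket f ^^ Suc j) w]\<^sub>L + [f, [e, (bracket f ^^ Suc j) w]\<^sub>L]\<^sub>L"
    by (simp add: bracket_leibniz[of e f "[f, (bracket f ^^ j) w]\<^sub>L"] assms(1))
  also have "\<dots> = (\<mu> + of_nat (Suc j) * - a) *s (bracket f ^^ Suc j) w +
      (of_nat (Suc j) * (\<mu> - a * of_nat j / 2)) *s (bracket f ^^ Suc j) w"
    unfolding Suc.IH funpow_bracket_eigenvector[OF assms(2,4)] by (simp add: bracket_scale_right)
  also have "\<dots> = (\<mu> + of_nat (Suc j) * - a + of_nat (Suc j) * (\<mu> - a * of_nat j / 2)) *s
      (bracket f ^^ Suc j) w"
    by (simp only: scale_left_distrib)
  also have "\<mu> + of_nat (Suc j) * - a + of_nat (Suc j) * (\<mu> - a * of_nat j / 2) =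
      of_nat (Suc (Suc j)) * (\<mu> - a * of_nat (Suc j) / 2)"
    by (simp add: field_simps)
  finally show ?case .
qed

text \<open>For \<open>a = 2\<close> this is the integrality of the weights of an \<open>sl\<^sub>2\<close>-triple, for \<open>a = 0\<close> the
  nilpotency of a commutator that commutes with its two entries.\<close>

lemma sl2_string:
  assumes "[e, f]\<^sub>L = h" "[h, e]\<^sub>L = a *s e" "[h, f]\<^sub>L = - a *s f"
    and "\<And>v. \<exists>n. (bracket e ^^ n) v = 0" "\<And>v. \<exists>n. (bracket f ^^ n) v = 0"
    and "[h, v]\<^sub>L = \<mu> *s v" "v \<noteq> 0"
  obtains m j where "(bracket e ^^ m) v \<noteq> 0" "\<mu> + of_nat m * a = a * of_nat j / 2"
proof -
  obtain m where m: "(bracket e ^^ m) v \<noteq> 0" "(bracket e ^^ Suc m) v = 0"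
    using assms(4,7) ex_least_nat_less[of "\<lambda>n. (bracket e ^^ n) v = 0"]
    by (metis funpow_0 le_refl)
  define w where "w = (bracket e ^^ m) v"
  have w: "[e, w]\<^sub>L = 0" "w \<noteq> 0" "[h, w]\<^sub>L = (\<mu> + of_nat m * a) *s w"
    using m funpow_bracket_eigenvector[OF assms(2,6)] by (auto simp: w_def)
  obtain j where j: "(bracket f ^^ j) w \<noteq> 0" "(bracket f ^^ Suc j) w = 0"
    using assms(5) w(2) ex_least_nat_less[of "\<lambda>n. (bracket f ^^ n) w = 0"]
    by (metis funpow_0 le_refl)
  \<comment> \<open>The \<open>f\<close>-string of the highest weight vector \<open>w\<close> ends
    at \<open>j\<close>, so the coefficient of a nonzero vector vanishes; its factor
    \<open>of_nat (Suc j)\<close> is nonzero in characteristic 0.\<close>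
  have "(of_nat (Suc j) * (\<mu> + of_nat m * a - a * of_nat j / 2)) *s (bracket f ^^ j) w = 0"
    using highest_weight_bracket[OF assms(1,3) w(1,3), of j] j(2) by simp
  then have "\<mu> + of_nat m * a = a * of_nat j / 2"
    using j(1) by (simp del: of_nat_Suc)
  then show ?thesis
    using that m(1) by blast
qed

end

lemma int_span_module: "module (\<lambda>(n::int) (f::'v \<Rightarrow> 'k::field) x. of_int n * f x)"
  by unfold_locales (auto simp: fun_eq_iff algebra_simps)

subsection \<open>Minimal graded subalgebras\<close>

text \<open>Faithful means that \<open>ad\<close> is injective: this turns \<open>ad h = 0\<close>
  into \<open>h = 0\<close> for a commutator h of opposite root vectors.\<close>

locale faithful_torus = lie_algebra_char_0 scale bracket Basis
  for scale :: "'k::field_char_0 \<Rightarrow> 'l::ab_group_add \<Rightarrow> 'l"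
    and bracket :: "'l \<Rightarrow> 'l \<Rightarrow> 'l"
    and Basis :: "'l set" +
  fixes H :: "'l set"
  assumes torus: "torus H"
    and center: "(\<And>y. [x, y]\<^sub>L = 0) \<Longrightarrow> x = 0"
begin

definition graded :: "('l \<Rightarrow> 'k) set \<Rightarrow> 'l set"
  where "graded \<Psi> = span (H \<union> (\<Union>\<alpha>\<in>\<Psi>. root_space H \<alpha>))"

lemma ad_semisimple_torus: "h \<in> H \<Longrightarrow> ad_semisimple h"
  using torus by (simp add: torus_def)

lemma subspace_torus: "subspace H"
  using torus by (simp add: torus_def subalgebra_def)

lemma torus_bracket: "x \<in> H \<Longrightarrow> y \<in> H \<Longrightarrow> [x, y]\<^sub>L = 0"
  using torus torus_abelian by blast

lemma torus_weight_0: "h \<in> H \<Longrightarrow> h \<in> root_space H 0"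
  by (simp add: root_space_def torus_bracket)

lemma roots_outside: "\<alpha> \<in> roots H \<Longrightarrow> h \<notin> H \<Longrightarrow> \<alpha> h = 0"
  by (simp add: roots_def dual_space_def linear_maps_on_def)

lemma zero_not_root: "0 \<notin> roots H"
  by (simp add: roots_def)

lemma finite_roots: "finite (roots H)"
  by (rule finite_subset[OF _ finite_weights[of H]])
    (auto simp: roots_def dual_space_def linear_maps_on_def)

lemma finite_subset_roots: "\<Psi> \<subseteq> roots H \<Longrightarrow> finite \<Psi>"
  using finite_roots finite_subset by blast

lemma root_nonzero:
  assumes "\<alpha> \<in> roots H"
  obtains h where "h \<in> H" "\<alpha> h \<noteq> 0"
proof -
  have "\<alpha> \<noteq> 0"
    using assms zero_not_root by blast
  then show ?thesis
    using that roots_outside[OF assms] by (metis ext zero_fun_def)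
qed

lemma root_vector_nilpotent:
  assumes "\<alpha> \<in> roots H" "x \<in> root_space H \<alpha>"
  shows "\<exists>n. (bracket x ^^ n) v = 0"
  using assms root_nonzero ad_nilpotent ad_semisimple_torus root_spaceD by metis

lemma torus_subset_graded: "H \<subseteq> graded \<Psi>"
  by (auto simp: graded_def intro: span_base)

lemma root_space_subset_graded: "\<alpha> \<in> \<Psi> \<Longrightarrow> root_space H \<alpha> \<subseteq> graded \<Psi>"
  by (auto simp: graded_def intro: span_base)

lemma subspace_graded: "subspace (graded \<Psi>)"
  by (simp add: graded_def)

lemma graded_decomposition:
  assumes "\<Psi> \<subseteq> roots H" "x \<in> graded \<Psi>"
  obtains v where "v 0 \<in> H" "\<And>\<alpha>. \<alpha> \<in> insert 0 \<Psi> \<Longrightarrow> v \<alpha> \<in> root_space H \<alpha>"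
    "x = (\<Sum>\<alpha>\<in>insert 0 \<Psi>. v \<alpha>)"
proof -
  \<comment> \<open>Index 0 is free to carry \<open>H\<close>, since 0 is not a root. This keeps the
    weight 0 component in \<open>H\<close> itself, not just in the weight 0 space of the whole
    algebra.\<close>
  define S where "S \<alpha> = (if \<alpha> = 0 then H else root_space H \<alpha>)" for \<alpha>
  have "0 \<notin> \<Psi>"
    using assms zero_not_root by blast
  then have "H \<union> (\<Union>\<alpha>\<in>\<Psi>. root_space H \<alpha>) = (\<Union>\<alpha>\<in>insert 0 \<Psi>. S \<alpha>)"
    by (auto simp: S_def)
  then have x: "x \<in> span (\<Union>\<alpha>\<in>insert 0 \<Psi>. S \<alpha>)"
    using assms by (simp add: graded_def)
  have "finite (insert 0 \<Psi>)" "\<And>\<alpha>. subspace (S \<alpha>)"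
    using finite_subset_roots[OF assms(1)] subspace_torus subspace_root_space by (auto simp: S_def)
  from span_UN_subspaces[OF this x] obtain v
    where v: "\<And>\<alpha>. \<alpha> \<in> insert 0 \<Psi> \<Longrightarrow> v \<alpha> \<in> S \<alpha>" "x = (\<Sum>\<alpha>\<in>insert 0 \<Psi>. v \<alpha>)"
    by metis
  show ?thesis
  proof (rule that)
    show "v 0 \<in> H"
      using v(1)[of 0] by (simp add: S_def)
    then show "v \<alpha> \<in> root_space H \<alpha>" if "\<alpha> \<in> insert 0 \<Psi>" for \<alpha>
      using v(1)[OF that] torus_weight_0 by (auto simp: S_def split: if_splits)
  qed (rule v(2))
qed

text \<open>A weight vector equals its own component of that weight. Applied to a nonzero bracket of
  two root vectors, this shows that the sum of their roots is 0 or again in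
  \<open>\<Psi>\<close>.\<close>

lemma graded_weight_vector:
  assumes "\<Psi> \<subseteq> roots H" "x \<in> graded \<Psi>" "x \<in> root_space H \<beta>" "\<And>h. h \<notin> H \<Longrightarrow> \<beta> h = 0" "x \<noteq> 0"
  shows "\<beta> = 0 \<and> x \<in> H \<or> \<beta> \<in> \<Psi>"
proof -
  obtain v where v: "v 0 \<in> H" "\<And>\<alpha>. \<alpha> \<in> insert 0 \<Psi> \<Longrightarrow> v \<alpha> \<in> root_space H \<alpha>"
    "x = (\<Sum>\<alpha>\<in>insert 0 \<Psi>. v \<alpha>)"
    using graded_decomposition[OF assms(1,2)] by metis
  have "x = (if \<beta> \<in> insert 0 \<Psi> then v \<beta> else 0)"
    using assms v finite_subset_roots roots_outside unfolding v(3)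
    by (intro weight_sum_component) auto
  then show ?thesis
    using v(1) assms(5) by (auto split: if_splits)
qed

lemma graded_weight_0:
  assumes "\<Psi> \<subseteq> roots H" "x \<in> graded \<Psi>" "x \<in> root_space H 0"
  shows "x \<in> H"
  using graded_weight_vector[OF assms] assms(1) zero_not_root subspace_0[OF subspace_torus]
  by (cases "x = 0") auto

text \<open>If \<open>\<alpha>\<close> vanished at the commutator h, the case \<open>a = 0\<close>
  of \<open>sl2_string\<close> would make every eigenvalue of \<open>ad h\<close> zero. Being
  diagonalizable, \<open>ad h\<close> would be zero, and h central.\<close>

lemma commutator_root_nonzero:
  assumes "\<alpha> \<in> roots H" "- \<alpha> \<in> roots H" "e \<in> root_space H \<alpha>" "f \<in> root_space H (- \<alpha>)"
    and "[e, f]\<^sub>L \<in> H" "[e, f]\<^sub>L \<noteq> 0"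
  shows "\<alpha> [e, f]\<^sub>L \<noteq> 0"
proof
  let ?h = "[e, f]\<^sub>L"
  assume 0: "\<alpha> ?h = 0"
  have "{v. \<exists>c. [?h, v]\<^sub>L = c *s v} \<subseteq> {v. [?h, v]\<^sub>L \<in> {0}}"
  proof (intro subsetI CollectI, elim CollectE exE)
    fix v c assume v: "[?h, v]\<^sub>L = c *s v"
    show "[?h, v]\<^sub>L \<in> {0}"
    proof (cases "v = 0")
      case False
      have he: "[?h, e]\<^sub>L = 0 *s e" "[?h, f]\<^sub>L = - 0 *s f"
        using assms 0 root_spaceD[of e H \<alpha> ?h] root_spaceD[of f H "- \<alpha>" ?h] by simp_all
      obtain m j :: nat where "c + of_nat m * 0 = 0 * of_nat j / 2"
        using sl2_string[OF refl he _ _ v False] root_vector_nilpotent assms(1-4) by metis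
      then show ?thesis
        using v by simp
    qed simp
  qed
  then have "span {v. \<exists>c. [?h, v]\<^sub>L = c *s v} \<subseteq> {v. [?h, v]\<^sub>L \<in> {0}}"
    by (intro span_minimal subspace_bracket_vimage_right) simp_all
  then have "[?h, v]\<^sub>L = 0" for v
    using ad_semisimple_torus[OF assms(5)] unfolding ad_semisimple_def by blast
  then show False
    using center assms(6) by blast
qed

text \<open>A nonzero bracket of root vectors for \<open>\<Psi>'\<close> lies in
  \<open>graded \<Psi>\<close>, so it is in \<open>H\<close> or its weight is in
  \<open>\<Psi>\<close>. Hence closure of \<open>\<Psi>'\<close> has to be tested only for sums that
  stay in \<open>\<Psi>\<close>.\<close>

lemma subalgebra_gradedI:
  assumes "\<Psi> \<subseteq> roots H" "subalgebra (graded \<Psi>)" "\<Psi>' \<subseteq> \<Psi>"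
    and "\<And>\<alpha> \<beta>. \<alpha> \<in> \<Psi>' \<Longrightarrow> \<beta> \<in> \<Psi>' \<Longrightarrow> \<alpha> + \<beta> \<in> \<Psi> \<Longrightarrow> \<alpha> + \<beta> \<in> \<Psi>'"
  shows "subalgebra (graded \<Psi>')"
  unfolding subalgebra_def
proof (intro conjI ballI subspace_graded)
  let ?G = "H \<union> (\<Union>\<alpha>\<in>\<Psi>'. root_space H \<alpha>)"
  fix x y assume "x \<in> graded \<Psi>'" "y \<in> graded \<Psi>'"
  then have "x \<in> span ?G" "y \<in> span ?G"
    by (simp_all add: graded_def)
  then show "[x, y]\<^sub>L \<in> graded \<Psi>'"
  proof (rule span_bracket_mem[OF subspace_graded, rotated 1])
    fix x y
    assume xy: "x \<in> ?G" "y \<in> ?G"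
    have H: "[h, z]\<^sub>L \<in> graded \<Psi>'" "[z, h]\<^sub>L \<in> graded \<Psi>'"
      if "h \<in> H" "z \<in> ?G" for h z
    proof -
      show "[h, z]\<^sub>L \<in> graded \<Psi>'"
        using that torus_bracket root_space_subset_graded[THEN subsetD]
        by (auto simp: root_spaceD subspace_0[OF subspace_graded]
            intro!: subspace_scale[OF subspace_graded])
      then show "[z, h]\<^sub>L \<in> graded \<Psi>'"
        using subspace_graded subspace_neg bracket_antisym by metis
    qed
    show "[x, y]\<^sub>L \<in> graded \<Psi>'"
    proof (cases "x \<in> H \<or> y \<in> H \<or> [x, y]\<^sub>L = 0")
      case True
      then show ?thesis
        using H(1)[OF _ xy(2)] H(2)[OF _ xy(1)] subspace_0[OF subspace_graded] by auto
    next
      case False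
      then obtain \<alpha> \<beta> where \<alpha>: "\<alpha> \<in> \<Psi>'" "x \<in> root_space H \<alpha>" and \<beta>: "\<beta> \<in> \<Psi>'" "y \<in> root_space H \<beta>"
        using xy by blast
      have "[x, y]\<^sub>L \<in> graded \<Psi>"
        using \<alpha> \<beta> assms(2,3) root_space_subset_graded[of _ \<Psi>] unfolding subalgebra_def by blast
      moreover have w: "[x, y]\<^sub>L \<in> root_space H (\<alpha> + \<beta>)"
        using \<alpha> \<beta> root_space_bracket by blast
      moreover have "(\<alpha> + \<beta>) h = 0" if "h \<notin> H" for h
      proof -
        have "\<alpha> \<in> roots H" "\<beta> \<in> roots H"
          using \<alpha> \<beta> assms(1,3) by auto
        then show ?thesis
          using that roots_outside[of \<alpha> h] roots_outside[of \<beta> h] by simp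
      qed
      ultimately have "\<alpha> + \<beta> = 0 \<and> [x, y]\<^sub>L \<in> H \<or> \<alpha> + \<beta> \<in> \<Psi>"
        using False assms(1) graded_weight_vector by blast
      then show ?thesis
        using w \<alpha> \<beta> assms(4) torus_subset_graded root_space_subset_graded[of _ \<Psi>'] by blast
    qed
  qed
qed

lemma Q_graded_subalgebra_graded:
  "Q_graded_subalgebra H L \<longleftrightarrow>
    (\<exists>\<Psi>\<subseteq>roots H. L = graded \<Psi> \<and> subalgebra L \<and> root_lattice H = int_span \<Psi>)"
  unfolding Q_graded_subalgebra_def using torus_subset_graded by (auto simp: graded_def)

text \<open>
  If \<open>h = [e, f] \<noteq> 0\<close>, the roots of \<open>L\<close> with nonnegative value at \<open>h\<close> (rescaled so that
  \<open>\<alpha> h = 2\<close>) form a smaller graded subalgebra. It spans the same lattice, because raising by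
  \<open>e\<close> moves every other root of \<open>L\<close> to one of these along multiples of \<open>\<alpha>\<close>.
\<close>

lemma minimal_bracket_opposite:
  assumes "minimal_Q_graded_subalgebra H (graded \<Psi>)" "\<Psi> \<subseteq> roots H" "root_lattice H = int_span \<Psi>"
    and "\<alpha> \<in> \<Psi>" "- \<alpha> \<in> \<Psi>" "e \<in> root_space H \<alpha>" "f \<in> root_space H (- \<alpha>)"
  shows "[e, f]\<^sub>L = 0"
proof (rule ccontr)
  interpret M: module "\<lambda>(n::int) (f::'l \<Rightarrow> 'k) x. of_int n * f x"
    by (rule int_span_module)
  define h where "h = [e, f]\<^sub>L"
  define a where "a = \<alpha> h"
  \<comment> \<open>Nonnegativity without an order on the field: scaled so that
    \<open>\<alpha>\<close> has value 2 at \<open>h\<close>, the value of \<open>\<beta>\<close> is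
    the natural number \<open>n\<close>. Thus \<open>\<alpha>\<close> belongs with
    \<open>n = 2\<close>, while \<open>- \<alpha>\<close> would need -2.\<close>
  define \<Psi>' where "\<Psi>' = {\<beta> \<in> \<Psi>. \<exists>n::nat. 2 * \<beta> h = a * of_nat n}"
  assume "[e, f]\<^sub>L \<noteq> 0"
  then have h0: "h \<noteq> 0"
    by (simp add: h_def)
  have sub: "subalgebra (graded \<Psi>)"
    using assms(1) by (simp add: minimal_Q_graded_subalgebra_def Q_graded_subalgebra_def)
  have ef: "e \<in> graded \<Psi>" "f \<in> graded \<Psi>"
    using assms root_space_subset_graded by blast+
  have "h \<in> graded \<Psi>"
    using sub ef by (simp add: h_def subalgebra_def)
  moreover have "h \<in> root_space H 0"
    using root_space_bracket[OF assms(6,7)] by (simp add: h_def)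
  ultimately have h: "h \<in> H"
    using graded_weight_0 assms(2) by blast
  have a: "a \<noteq> 0"
    using commutator_root_nonzero[of \<alpha> e f] assms h h0 unfolding a_def h_def by blast
  have he: "[h, e]\<^sub>L = a *s e" "[h, f]\<^sub>L = - a *s f"
    using assms root_spaceD[OF _ h] by (simp_all add: a_def)
  have \<alpha>: "\<alpha> \<in> \<Psi>'"
    using assms(4) by (auto simp: \<Psi>'_def a_def intro!: exI[of _ 2])
  have neg: "- \<alpha> \<notin> \<Psi>'"
  proof
    assume "- \<alpha> \<in> \<Psi>'"
    then obtain n :: nat where "2 * - a = a * of_nat n"
      by (auto simp: \<Psi>'_def a_def)
    then have "a * (of_nat n + 2) = 0"
      by (simp add: algebra_simps neg_eq_iff_add_eq_0)
    then have "of_nat (n + 2) = (0::'k)"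
      using a by (simp add: add.commute)
    then show False
      by (simp only: of_nat_eq_0_iff)
  qed
  have roots': "\<Psi>' \<subseteq> roots H"
    using assms(2) by (auto simp: \<Psi>'_def)
  have sub': "subalgebra (graded \<Psi>')"
  proof (rule subalgebra_gradedI[OF assms(2) sub])
    fix \<beta> \<gamma> assume "\<beta> \<in> \<Psi>'" "\<gamma> \<in> \<Psi>'" "\<beta> + \<gamma> \<in> \<Psi>"
    moreover from this obtain n m :: nat where "2 * \<beta> h = a * of_nat n" "2 * \<gamma> h = a * of_nat m"
      by (auto simp: \<Psi>'_def)
    then have "2 * (\<beta> + \<gamma>) h = a * of_nat (n + m)"
      by (simp add: algebra_simps)
    ultimately show "\<beta> + \<gamma> \<in> \<Psi>'"
      unfolding \<Psi>'_def by blast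
  qed (auto simp: \<Psi>'_def)
  have "\<Psi> \<subseteq> M.span \<Psi>'"
  proof
    fix \<beta> assume \<beta>: "\<beta> \<in> \<Psi>"
    then obtain v where v: "v \<in> root_space H \<beta>" "v \<noteq> 0"
      using assms(2) subspace_0[OF subspace_root_space, of H \<beta>] by (fastforce simp: roots_def)
    obtain m j where mj: "(bracket e ^^ m) v \<noteq> 0" "\<beta> h + of_nat m * a = a * of_nat j / 2"
      using sl2_string[OF h_def[symmetric] he _ _ root_spaceD[OF v(1) h] v(2)]
        root_vector_nilpotent assms by (metis subsetD)
    \<comment> \<open>The weight of a nonzero vector in the \<open>e\<close>-string through
      \<open>v\<close>; by \<open>sl2_string\<close> its scaled value at \<open>h\<close> is the
      natural number \<open>j\<close>. The string may also end in \<open>H\<close>: then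
      \<open>\<gamma> = 0\<close>, which lies in every span.\<close>
    define \<gamma> where "\<gamma> = \<beta> + (\<lambda>x. of_int (int m) * \<alpha> x)"
    have "(bracket e ^^ n) v \<in> graded \<Psi>" for n
      using sub ef(1) root_space_subset_graded[OF \<beta>] v(1) unfolding subalgebra_def
      by (induction n) auto
    moreover have "(bracket e ^^ m) v \<in> root_space H \<gamma>"
      unfolding root_space_def \<gamma>_def
      using funpow_bracket_eigenvector[OF root_spaceD[OF assms(6)] root_spaceD[OF v(1)]] by simp
    moreover have "\<gamma> x = 0" if "x \<notin> H" for x
    proof -
      have "\<alpha> \<in> roots H" "\<beta> \<in> roots H"
        using \<beta> assms(2,4) by auto
      then show ?thesis
        using that roots_outside[of \<alpha> x] roots_outside[of \<beta> x] by (simp add: \<gamma>_def)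
    qed
    ultimately have "\<gamma> = 0 \<or> \<gamma> \<in> \<Psi>"
      using graded_weight_vector assms(2) mj(1) by blast
    moreover have "\<gamma> \<in> \<Psi>' " if "\<gamma> \<in> \<Psi>"
      using that mj(2) by (auto simp: \<Psi>'_def \<gamma>_def a_def field_simps intro!: exI[of _ j])
    ultimately have "\<gamma> \<in> M.span \<Psi>'"
      using M.span_zero M.span_base by blast
    then have "\<gamma> - (\<lambda>x. of_int (int m) * \<alpha> x) \<in> M.span \<Psi>'"
      by (rule M.span_diff[OF _ M.span_scale[OF M.span_base[OF \<alpha>]]])
    then show "\<beta> \<in> M.span \<Psi>'"
      by (simp add: \<gamma>_def)
  qed
  then have "M.span \<Psi> = M.span \<Psi>'"
    unfolding M.span_eq by (auto simp: \<Psi>'_def intro: M.span_base)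
  then have "root_lattice H = int_span \<Psi>'"
    by (simp add: assms(3) int_span_def)
  then have "Q_graded_subalgebra H (graded \<Psi>')"
    unfolding Q_graded_subalgebra_graded using sub' roots' by blast
  moreover have "graded \<Psi>' \<subset> graded \<Psi>"
  proof
    show "graded \<Psi>' \<subseteq> graded \<Psi>"
      unfolding graded_def by (intro span_mono) (auto simp: \<Psi>'_def)
    have "f \<noteq> 0" "- \<alpha> \<noteq> 0"
      using h0 assms(2,5) zero_not_root by (auto simp: h_def)
    moreover have "(- \<alpha>) x = 0" if "x \<notin> H" for x
      using that assms(2,5) roots_outside by blast
    ultimately have "f \<notin> graded \<Psi>'"
      using graded_weight_vector[OF roots'] assms(7) neg by blast
    then show "graded \<Psi>' \<noteq> graded \<Psi>"
      using ef by blast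
  qed
  ultimately show False
    using assms(1) by (auto simp: minimal_Q_graded_subalgebra_def)
qed

end

subsection \<open>Engel's theorem for the root space part\<close>

text \<open>\<open>bracket_opposite\<close> is the form in which minimality is used from here on.
  Opposite roots may both occur in \<open>\<Psi>\<close>, but their root vectors commute.\<close>

locale root_nilradical = faithful_torus scale bracket Basis H
  for scale :: "'k::field_char_0 \<Rightarrow> 'l::ab_group_add \<Rightarrow> 'l"
    and bracket :: "'l \<Rightarrow> 'l \<Rightarrow> 'l"
    and Basis H :: "'l set" +
  fixes \<Psi> :: "('l \<Rightarrow> 'k) set"
  assumes roots: "\<Psi> \<subseteq> roots H"
    and subalgebra: "subalgebra (graded \<Psi>)"
    and bracket_opposite: "\<lbrakk>\<alpha> \<in> \<Psi>; - \<alpha> \<in> \<Psi>; e \<in> root_space H \<alpha>; f \<in> root_space H (- \<alpha>)\<rbrakk> \<Longrightarrow>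
      [e, f]\<^sub>L = 0"
begin

definition N :: "'l set"
  where "N = span (\<Union>\<alpha>\<in>\<Psi>. root_space H \<alpha>)"

text \<open>\<open>H\<close>-stability makes such a subalgebra the sum of its weight components, so
  that it can be enlarged by single root vectors, whose nilpotency is known.\<close>

definition stable_subalgebra :: "'l set \<Rightarrow> bool"
  where "stable_subalgebra K \<longleftrightarrow> subspace K \<and> K \<subseteq> N \<and>
    (\<forall>x\<in>K. \<forall>y\<in>K. [x, y]\<^sub>L \<in> K) \<and> (\<forall>h\<in>H. \<forall>x\<in>K. [h, x]\<^sub>L \<in> K)"

lemma subspace_N: "subspace N"
  by (simp add: N_def)

lemma root_space_subset_N: "\<alpha> \<in> \<Psi> \<Longrightarrow> root_space H \<alpha> \<subseteq> N"
  by (auto simp: N_def intro: span_base)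

lemma finite_Psi: "finite \<Psi>"
  using roots by (rule finite_subset_roots)

lemma Psi_outside: "\<alpha> \<in> \<Psi> \<Longrightarrow> h \<notin> H \<Longrightarrow> \<alpha> h = 0"
  using roots roots_outside by blast

lemma graded_bracket: "x \<in> graded \<Psi> \<Longrightarrow> y \<in> graded \<Psi> \<Longrightarrow> [x, y]\<^sub>L \<in> graded \<Psi>"
  using subalgebra by (simp add: subalgebra_def)

lemma N_subset_graded: "N \<subseteq> graded \<Psi>"
  unfolding N_def graded_def by (intro span_mono) auto

lemma N_decomposition:
  assumes "x \<in> N"
  obtains v where "\<And>\<alpha>. \<alpha> \<in> \<Psi> \<Longrightarrow> v \<alpha> \<in> root_space H \<alpha>" "x = (\<Sum>\<alpha>\<in>\<Psi>. v \<alpha>)"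
  using span_UN_subspaces[OF finite_Psi subspace_root_space assms[unfolded N_def]] by metis

lemma graded_split:
  assumes "x \<in> graded \<Psi>"
  obtains h n where "h \<in> H" "n \<in> N" "x = h + n"
proof -
  obtain h n where "h \<in> span H" "n \<in> N" "x = h + n"
    using assms unfolding graded_def span_Un N_def by blast
  moreover have "span H = H"
    using subspace_torus by (simp add: span_eq_iff)
  ultimately show ?thesis
    using that by metis
qed

lemma stable_subalgebra_N: "stable_subalgebra N"
  unfolding stable_subalgebra_def
proof (intro conjI ballI subspace_N subset_refl)
  fix h x assume h: "h \<in> H" and "x \<in> N"
  have "(\<Union>\<alpha>\<in>\<Psi>. root_space H \<alpha>) \<subseteq> {x. [h, x]\<^sub>L \<in> N}"
    using root_spaceD[OF _ h] root_space_subset_N[THEN subsetD]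
    by (auto intro!: subspace_scale[OF subspace_N])
  then have "N \<subseteq> {x. [h, x]\<^sub>L \<in> N}"
    using span_minimal[OF _ subspace_bracket_vimage_right[OF subspace_N]] by (simp add: N_def)
  then show "[h, x]\<^sub>L \<in> N"
    using \<open>x \<in> N\<close> by blast
next
  fix x y assume "x \<in> N" "y \<in> N"
  then have "x \<in> span (\<Union>\<alpha>\<in>\<Psi>. root_space H \<alpha>)" "y \<in> span (\<Union>\<alpha>\<in>\<Psi>. root_space H \<alpha>)"
    by (simp_all add: N_def)
  then show "[x, y]\<^sub>L \<in> N"
  proof (rule span_bracket_mem[OF subspace_N, rotated 1])
    fix x y assume "x \<in> (\<Union>\<alpha>\<in>\<Psi>. root_space H \<alpha>)" "y \<in> (\<Union>\<alpha>\<in>\<Psi>. root_space H \<alpha>)"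
    then obtain \<alpha> \<beta> where \<alpha>: "\<alpha> \<in> \<Psi>" "x \<in> root_space H \<alpha>" and \<beta>: "\<beta> \<in> \<Psi>" "y \<in> root_space H \<beta>"
      by blast
    show "[x, y]\<^sub>L \<in> N"
    proof (cases "[x, y]\<^sub>L = 0")
      case True
      then show ?thesis
        using subspace_0[OF subspace_N] by simp
    next
      case False
      have w: "[x, y]\<^sub>L \<in> root_space H (\<alpha> + \<beta>)"
        using \<alpha> \<beta> root_space_bracket by blast
      have "x \<in> graded \<Psi>" "y \<in> graded \<Psi>"
        using \<alpha> \<beta> root_space_subset_graded by blast+
      then have "[x, y]\<^sub>L \<in> graded \<Psi>"
        by (rule graded_bracket)
      moreover have "(\<alpha> + \<beta>) h = 0" if "h \<notin> H" for h
        using Psi_outside[OF \<alpha>(1) that] Psi_outside[OF \<beta>(1) that] by simp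
      ultimately consider "\<alpha> + \<beta> = 0" | "\<alpha> + \<beta> \<in> \<Psi>"
        using graded_weight_vector[OF roots _ w] False by blast
      then show ?thesis
      proof cases
        case 1
        then have "\<beta> = - \<alpha>"
          by (simp add: eq_neg_iff_add_eq_0 add.commute)
        then show ?thesis
          using bracket_opposite \<alpha> \<beta> False by blast
      next
        case 2
        then show ?thesis
          using w root_space_subset_N by blast
      qed
    qed
  qed
qed

text \<open>As \<open>[x, x] = 0\<close>, the new vector adds no bracket outside \<open>K\<close>.
  Landing in \<open>K\<close>, not merely in the enlarged span, is what later puts [N, N] into a
  maximal stable subalgebra.\<close>

lemma span_insert_bracket:
  assumes "stable_subalgebra K" "\<And>k. k \<in> K \<Longrightarrow> [k, x]\<^sub>L \<in> K"
    and "y \<in> span (insert x K)" "z \<in> span (insert x K)"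
  shows "[y, z]\<^sub>L \<in> K"
proof (rule span_bracket_mem[OF _ _ assms(3,4)])
  show K: "subspace K"
    using assms(1) by (simp add: stable_subalgebra_def)
  fix y z assume "y \<in> insert x K" "z \<in> insert x K"
  moreover have "[x, k]\<^sub>L \<in> K" if "k \<in> K" for k
    using assms(2)[OF that] subspace_neg[OF K] by (metis bracket_antisym)
  ultimately show "[y, z]\<^sub>L \<in> K"
    using assms(1,2) subspace_0[OF K] by (auto simp: stable_subalgebra_def bracket_self)
qed

lemma stable_subalgebra_insert:
  assumes "stable_subalgebra K" "\<alpha> \<in> \<Psi>" "x \<in> root_space H \<alpha>" "\<And>k. k \<in> K \<Longrightarrow> [k, x]\<^sub>L \<in> K"
  shows "stable_subalgebra (span (insert x K))"
  unfolding stable_subalgebra_def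
proof (intro conjI ballI subspace_span)
  have K: "K \<subseteq> span (insert x K)"
    using span_superset[of "insert x K"] by blast
  show "span (insert x K) \<subseteq> N"
    using assms root_space_subset_N subspace_N
    by (intro span_minimal) (auto simp: stable_subalgebra_def)
  show "[y, z]\<^sub>L \<in> span (insert x K)" if "y \<in> span (insert x K)" "z \<in> span (insert x K)" for y z
    using span_insert_bracket[OF assms(1,4) that] K by blast
  fix h y assume h: "h \<in> H" and y: "y \<in> span (insert x K)"
  have "[h, z]\<^sub>L \<in> span (insert x K)" if "z \<in> insert x K" for z
  proof (cases "z = x")
    case True
    then show ?thesis
      using root_spaceD[OF assms(3) h] by (simp add: span_scale span_base)
  next
    case False
    then show ?thesis
      using that assms(1) h K by (auto simp: stable_subalgebra_def)
  qed
  then have "span (insert x K) \<subseteq> {z. [h, z]\<^sub>L \<in> span (insert x K)}"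
    by (intro span_minimal subspace_bracket_vimage_right) auto
  then show "[h, y]\<^sub>L \<in> span (insert x K)"
    using y by blast
qed

text \<open>The conclusion of Engel's theorem for the action on \<open>V / U\<close>, phrased without quotients.\<close>

definition engel :: "'l set \<Rightarrow> bool"
  where "engel K \<longleftrightarrow> (\<forall>U V. subspace U \<and> subspace V \<and> U \<subset> V \<and>
    (\<forall>k\<in>K. \<forall>u\<in>U. [k, u]\<^sub>L \<in> U) \<and> (\<forall>k\<in>K. \<forall>v\<in>V. [k, v]\<^sub>L \<in> V) \<longrightarrow>
    (\<exists>v\<in>V - U. \<forall>k\<in>K. [k, v]\<^sub>L \<in> U))"

text \<open>\<open>engel\<close> for the action of \<open>K'\<close> on \<open>K\<close> modulo
  \<open>K'\<close> gives an element normalizing \<open>K'\<close>. The normalizer \<open>S\<close>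
  in \<open>K\<close> is \<open>H\<close>-stable, so it contains the weight components of that
  element, and one of them lies outside \<open>K'\<close>.\<close>

lemma engel_normalizer:
  assumes "engel K'" "stable_subalgebra K'" "stable_subalgebra K" "K' \<subset> K"
  obtains \<alpha> x where "\<alpha> \<in> \<Psi>" "x \<in> root_space H \<alpha>" "x \<in> K" "x \<notin> K'" "\<And>k. k \<in> K' \<Longrightarrow> [k, x]\<^sub>L \<in> K'"
proof -
  define S where "S = {z \<in> K. \<forall>k\<in>K'. [k, z]\<^sub>L \<in> K'}"
  have K: "subspace K" "subspace K'"
    using assms by (simp_all add: stable_subalgebra_def)
  have "\<exists>z\<in>K - K'. \<forall>k\<in>K'. [k, z]\<^sub>L \<in> K'"
    using assms(2-4) K
    by (intro assms(1)[unfolded engel_def, rule_format]) (auto simp: stable_subalgebra_def)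
  then obtain z where z: "z \<in> S" "z \<notin> K'"
    unfolding S_def by blast
  have S: "subspace S"
    using K unfolding S_def subspace_def by (auto simp: bracket_add_right bracket_scale_right)
  have stable: "[h, u]\<^sub>L \<in> S" if "h \<in> H" "u \<in> S" for h u
  proof -
    have "[k, [h, u]\<^sub>L]\<^sub>L \<in> K'" if "k \<in> K'" for k
    proof -
      have "[k, h]\<^sub>L \<in> K'"
        using assms(2) \<open>h \<in> H\<close> that bracket_antisym[of k h] subspace_neg[OF K(2)]
        by (auto simp: stable_subalgebra_def)
      then show ?thesis
        using assms(2) \<open>h \<in> H\<close> \<open>u \<in> S\<close> that K(2) unfolding bracket_leibniz[of k]
        by (auto simp: stable_subalgebra_def S_def intro!: subspace_add)
    qed
    then show ?thesis
      using that assms(3) by (auto simp: S_def stable_subalgebra_def)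
  qed
  have "z \<in> N"
    using z assms(3) by (auto simp: S_def stable_subalgebra_def)
  then obtain v where v: "\<And>\<alpha>. \<alpha> \<in> \<Psi> \<Longrightarrow> v \<alpha> \<in> root_space H \<alpha>" "z = (\<Sum>\<alpha>\<in>\<Psi>. v \<alpha>)"
    by (rule N_decomposition) metis
  have vS: "v \<alpha> \<in> S" if "\<alpha> \<in> \<Psi>" for \<alpha>
    using z(1) v Psi_outside that
    by (intro weight_component_mem[where v = v and H = H, OF finite_Psi S stable]) auto
  have "z \<in> K'" if "\<And>\<alpha>. \<alpha> \<in> \<Psi> \<Longrightarrow> v \<alpha> \<in> K'"
    unfolding v(2) using that by (rule subspace_sum[OF K(2)])
  then obtain \<alpha> where "\<alpha> \<in> \<Psi>" "v \<alpha> \<notin> K'"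
    using z(2) by blast
  then show ?thesis
    using that[of \<alpha> "v \<alpha>"] v(1) vS by (auto simp: S_def)
qed

lemma maximal_stable_subalgebra:
  assumes "stable_subalgebra K0" "K0 \<subset> K"
  obtains K' where "stable_subalgebra K'" "K0 \<subseteq> K'" "K' \<subset> K"
    "\<forall>K''. stable_subalgebra K'' \<and> K' \<subset> K'' \<and> K'' \<subseteq> K \<longrightarrow> K'' = K"
proof -
  define P where "P K' \<longleftrightarrow> stable_subalgebra K' \<and> K0 \<subseteq> K' \<and> K' \<subset> K" for K'
  have "P K0"
    using assms by (simp add: P_def)
  moreover have "\<forall>K'. P K' \<longrightarrow> dim K' < Suc dimension"
    using dim_subset_UNIV by (simp add: le_imp_less_Suc)
  ultimately obtain K' where K': "P K'" "\<And>K''. P K'' \<Longrightarrow> dim K'' \<le> dim K'"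
    using ex_has_greatest_nat[of P K0 dim "Suc dimension"] by blast
  note K' = K'[unfolded P_def]
  have "K'' = K" if *: "stable_subalgebra K''" "K' \<subset> K''" "K'' \<subseteq> K" for K''
  proof (rule ccontr)
    assume "K'' \<noteq> K"
    then have "dim K'' \<le> dim K'"
      using * K' by auto
    then have "K' = K''"
      using * K'(1) by (intro subspace_dim_equal) (auto simp: stable_subalgebra_def)
    then show False
      using * by blast
  qed
  then show ?thesis
    using K'(1) by (intro that[of K']) auto
qed

lemma span_insert_maximal:
  assumes "stable_subalgebra K" "stable_subalgebra K'" "K' \<subset> K" "engel K'"
    and "\<forall>K''. stable_subalgebra K'' \<and> K' \<subset> K'' \<and> K'' \<subseteq> K \<longrightarrow> K'' = K"
  obtains \<alpha> x where "\<alpha> \<in> \<Psi>" "x \<in> root_space H \<alpha>" "\<And>k. k \<in> K' \<Longrightarrow> [k, x]\<^sub>L \<in> K'"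
    "K = span (insert x K')"
proof -
  obtain \<alpha> x where x: "\<alpha> \<in> \<Psi>" "x \<in> root_space H \<alpha>" "x \<in> K" "x \<notin> K'" "\<And>k. k \<in> K' \<Longrightarrow> [k, x]\<^sub>L \<in> K'"
    using engel_normalizer assms(1-4) by metis
  have "stable_subalgebra (span (insert x K'))"
    using stable_subalgebra_insert[OF assms(2) x(1,2,5)] .
  moreover have "K' \<subset> span (insert x K')"
    using x(4) span_superset[of "insert x K'"] by blast
  moreover have "span (insert x K') \<subseteq> K"
    using assms(1,3) x(3) by (intro span_minimal) (auto simp: stable_subalgebra_def)
  ultimately have "span (insert x K') = K"
    using assms(5) by blast
  then show ?thesis
    using that x by metis
qed

text \<open>Induction on dimension: \<open>K\<close> is spanned by a maximal smaller stable
  subalgebra \<open>K'\<close> and a root vector \<open>x\<close> normalizing it. The vectors of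
  \<open>V\<close> that \<open>K'\<close> sends into \<open>U\<close> form a space preserved by
  \<open>x\<close>; nilpotency of \<open>ad x\<close> finds in it a vector outside \<open>U\<close>
  that \<open>x\<close> also sends into \<open>U\<close>.\<close>

lemma engel_stable_subalgebra: "stable_subalgebra K \<Longrightarrow> engel K"
proof (induction "dim K" arbitrary: K rule: less_induct)
  case less
  have K: "subspace K"
    using less.prems by (simp add: stable_subalgebra_def)
  have 0: "stable_subalgebra {0}"
    using subspace_0[OF subspace_N] by (auto simp: stable_subalgebra_def)
  show ?case
  proof (cases "K = {0}")
    case True
    then show ?thesis
      by (auto simp: engel_def subspace_0)
  next
    case False
    then have "{0} \<subset> K"
      using subspace_0[OF K] by blast
    then obtain K' where K': "stable_subalgebra K'" "K' \<subset> K"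
      "\<forall>K''. stable_subalgebra K'' \<and> K' \<subset> K'' \<and> K'' \<subseteq> K \<longrightarrow> K'' = K"
      using maximal_stable_subalgebra[OF 0] by metis
    have "dim K' < dim K"
      using K K' subspace_dim_equal[of K' K] by (force simp: stable_subalgebra_def)
    then have engel': "engel K'"
      using less.hyps K'(1) by blast
    obtain \<alpha> x where x: "\<alpha> \<in> \<Psi>" "x \<in> root_space H \<alpha>" "\<And>k. k \<in> K' \<Longrightarrow> [k, x]\<^sub>L \<in> K'"
      "K = span (insert x K')"
      using span_insert_maximal[OF less.prems K'(1,2) engel' K'(3)] by metis
    show ?thesis
      unfolding engel_def
    proof (intro allI impI, elim conjE)
      fix U V
      assume UV: "subspace U" "subspace V" "U \<subset> V"
        and KU: "\<forall>k\<in>K. \<forall>u\<in>U. [k, u]\<^sub>L \<in> U" and KV: "\<forall>k\<in>K. \<forall>v\<in>V. [k, v]\<^sub>L \<in> V"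
      define W where "W = {v \<in> V. \<forall>k\<in>K'. [k, v]\<^sub>L \<in> U}"
      have "\<exists>v\<in>V - U. \<forall>k\<in>K'. [k, v]\<^sub>L \<in> U"
        using UV KU KV K'(2) by (intro engel'[unfolded engel_def, rule_format]) auto
      then obtain w where w: "w \<in> W" "w \<notin> U"
        unfolding W_def by blast
      have xK: "x \<in> K"
        using x(4) by (auto intro: span_base)
      have xW: "[x, v]\<^sub>L \<in> W" if "v \<in> W" for v
      proof -
        have "[k, [x, v]\<^sub>L]\<^sub>L \<in> U" if "k \<in> K'" for k
          using x(3)[OF that] \<open>v \<in> W\<close> that KU xK UV(1) unfolding bracket_leibniz[of k]
          by (auto simp: W_def intro!: subspace_add)
        then show ?thesis
          using that KV xK by (auto simp: W_def)
      qed
      obtain n where "(bracket x ^^ n) w = 0"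
        using root_vector_nilpotent x(1,2) roots by blast
      then have "(bracket x ^^ n) w \<in> U" "(bracket x ^^ 0) w \<notin> U"
        using w(2) subspace_0[OF UV(1)] by simp_all
      then obtain m where m: "(bracket x ^^ m) w \<notin> U" "(bracket x ^^ Suc m) w \<in> U"
        using ex_least_nat_less[of "\<lambda>n. (bracket x ^^ n) w \<in> U"] by blast
      define v where "v = (bracket x ^^ m) w"
      have "(bracket x ^^ i) w \<in> W" for i
        using w(1) xW by (induction i) auto
      then have v: "v \<in> W" "v \<notin> U" "[x, v]\<^sub>L \<in> U"
        using m by (simp_all add: v_def)
      then have "K \<subseteq> {k. [k, v]\<^sub>L \<in> U}"
        unfolding x(4) using UV(1)
        by (intro span_minimal subspace_bracket_vimage_left) (auto simp: W_def)
      then show "\<exists>v\<in>V - U. \<forall>k\<in>K. [k, v]\<^sub>L \<in> U"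
        using v by (auto simp: W_def)
    qed
  qed
qed

text \<open>A stable subalgebra generating \<open>N\<close> modulo \<open>[N, N]\<close> is all of \<open>N\<close>: otherwise it lies in a
  maximal one, which has codimension one and is normalized by \<open>N\<close>, hence contains \<open>[N, N]\<close>.\<close>

lemma stable_subalgebra_generates:
  assumes "stable_subalgebra K"
    and "\<And>\<alpha>. \<alpha> \<in> \<Psi> \<Longrightarrow> root_space H \<alpha> \<subseteq> K \<or>
      root_space H \<alpha> \<subseteq> span {[x, y]\<^sub>L | x y. x \<in> N \<and> y \<in> N}"
  shows "K = N"
proof (rule ccontr)
  assume "K \<noteq> N"
  then have "K \<subset> N"
    using assms(1) by (auto simp: stable_subalgebra_def)
  then obtain K' where K': "stable_subalgebra K'" "K \<subseteq> K'" "K' \<subset> N"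
    "\<forall>K''. stable_subalgebra K'' \<and> K' \<subset> K'' \<and> K'' \<subseteq> N \<longrightarrow> K'' = N"
    using maximal_stable_subalgebra[OF assms(1)] by metis
  obtain \<alpha> x where x: "\<And>k. k \<in> K' \<Longrightarrow> [k, x]\<^sub>L \<in> K'" "N = span (insert x K')"
    using span_insert_maximal[OF stable_subalgebra_N K'(1,3) engel_stable_subalgebra[OF K'(1)] K'(4)]
    by metis
  have sub: "subspace K'"
    using K' by (simp add: stable_subalgebra_def)
  have "[y, z]\<^sub>L \<in> K'" if "y \<in> N" "z \<in> N" for y z
    using span_insert_bracket[OF K'(1) x(1)] that unfolding x(2) by blast
  then have "span {[x, y]\<^sub>L | x y. x \<in> N \<and> y \<in> N} \<subseteq> K'"
    using sub by (intro span_minimal) auto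
  then have "(\<Union>\<alpha>\<in>\<Psi>. root_space H \<alpha>) \<subseteq> K'"
    using assms(2) K'(2) by blast
  then have "N \<subseteq> K'"
    using sub span_minimal unfolding N_def by blast
  then show False
    using K'(3) by blast
qed

subsection \<open>Almost inner derivations\<close>

text \<open>Unlike in \<open>AID\<close>, values outside \<open>graded \<Psi>\<close> are left free,
  so that an inner derivation can be added without truncating it.\<close>

definition almost_inner :: "('l \<Rightarrow> 'l) \<Rightarrow> bool"
  where "almost_inner D \<longleftrightarrow>
    (\<forall>x\<in>graded \<Psi>. \<forall>y\<in>graded \<Psi>. D (x + y) = D x + D y) \<and>
    (\<forall>c. \<forall>x\<in>graded \<Psi>. D (c *s x) = c *s D x) \<and>
    (\<forall>x\<in>graded \<Psi>. \<forall>y\<in>graded \<Psi>. D [x, y]\<^sub>L = [D x, y]\<^sub>L + [x, D y]\<^sub>L) \<and>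
    (\<forall>x\<in>graded \<Psi>. \<exists>y\<in>graded \<Psi>. D x = [x, y]\<^sub>L)"

lemma almost_innerD:
  assumes "almost_inner D"
  shows "\<And>x y. x \<in> graded \<Psi> \<Longrightarrow> y \<in> graded \<Psi> \<Longrightarrow> D (x + y) = D x + D y"
    and "\<And>c x. x \<in> graded \<Psi> \<Longrightarrow> D (c *s x) = c *s D x"
    and "\<And>x y. x \<in> graded \<Psi> \<Longrightarrow> y \<in> graded \<Psi> \<Longrightarrow> D [x, y]\<^sub>L = [D x, y]\<^sub>L + [x, D y]\<^sub>L"
    and "\<And>x. x \<in> graded \<Psi> \<Longrightarrow> \<exists>y\<in>graded \<Psi>. D x = [x, y]\<^sub>L"
  using assms unfolding almost_inner_def by blast+

lemma almost_inner_0: "almost_inner D \<Longrightarrow> D 0 = 0"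
  using almost_innerD(4)[of D 0] subspace_0[OF subspace_graded] by auto

lemma almost_inner_mem: "almost_inner D \<Longrightarrow> x \<in> graded \<Psi> \<Longrightarrow> D x \<in> graded \<Psi>"
  using almost_innerD(4) graded_bracket by metis

lemma almost_inner_sum:
  assumes "almost_inner D" "\<And>a. a \<in> A \<Longrightarrow> f a \<in> graded \<Psi>"
  shows "D (sum f A) = (\<Sum>a\<in>A. D (f a))"
  using assms(2)
proof (induction A rule: infinite_finite_induct)
  case (insert a A)
  have "sum f A \<in> graded \<Psi>"
    using insert.prems by (intro subspace_sum[OF subspace_graded]) auto
  then show ?case
    using insert almost_innerD(1)[OF assms(1), of "f a" "sum f A"] by simp
qed (simp_all add: almost_inner_0 assms(1))

lemma almost_inner_add_inner:
  assumes "almost_inner D" "z \<in> graded \<Psi>"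
  shows "almost_inner (\<lambda>x. D x + [z, x]\<^sub>L)"
  unfolding almost_inner_def
proof (intro conjI ballI allI)
  fix x y assume xy: "x \<in> graded \<Psi>" "y \<in> graded \<Psi>"
  show "D (x + y) + [z, x + y]\<^sub>L = D x + [z, x]\<^sub>L + (D y + [z, y]\<^sub>L)"
    using almost_innerD(1)[OF assms(1) xy] by (simp add: bracket_add_right)
  show "D [x, y]\<^sub>L + [z, [x, y]\<^sub>L]\<^sub>L = [D x + [z, x]\<^sub>L, y]\<^sub>L + [x, D y + [z, y]\<^sub>L]\<^sub>L"
    using almost_innerD(3)[OF assms(1) xy]
    by (simp add: bracket_leibniz[of z] bracket_add_right bracket_add_left)
next
  fix c x assume x: "x \<in> graded \<Psi>"
  show "D (c *s x) + [z, c *s x]\<^sub>L = c *s (D x + [z, x]\<^sub>L)"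
    using almost_innerD(2)[OF assms(1) x] by (simp add: bracket_scale_right scale_right_distrib)
next
  fix x assume x: "x \<in> graded \<Psi>"
  obtain y where y: "y \<in> graded \<Psi>" "D x = [x, y]\<^sub>L"
    using almost_innerD(4)[OF assms(1) x] by blast
  then have "D x + [z, x]\<^sub>L = [x, y + - z]\<^sub>L"
    by (simp only: bracket_add_right bracket_minus_right bracket_antisym[of z x])
  then show "\<exists>y\<in>graded \<Psi>. D x + [z, x]\<^sub>L = [x, y]\<^sub>L"
    using y(1) assms(2) subspace_add subspace_neg subspace_graded by metis
qed

text \<open>Since \<open>[h0, h] = 0\<close>, \<open>D h\<close> commutes with the regular element
  \<open>h0\<close> and so has weight 0. But \<open>D h = [h, y]\<close>, and bracketing with
  \<open>h\<close> multiplies the weight 0 component of \<open>y\<close> by 0.\<close>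

lemma almost_inner_vanishes_torus:
  assumes D: "almost_inner D" and h0: "h0 \<in> H" "\<And>\<alpha>. \<alpha> \<in> \<Psi> \<Longrightarrow> \<alpha> h0 \<noteq> 0" "D h0 = 0"
    and h: "h \<in> H"
  shows "D h = 0"
proof -
  have hg: "h \<in> graded \<Psi>" "h0 \<in> graded \<Psi>"
    using h h0 torus_subset_graded by blast+
  have "[h0, D h]\<^sub>L = 0"
    using almost_innerD(3)[OF D hg(2,1)] h h0 almost_inner_0[OF D] by (simp add: torus_bracket)
  moreover obtain v where v: "v 0 \<in> H" "\<And>\<alpha>. \<alpha> \<in> insert 0 \<Psi> \<Longrightarrow> v \<alpha> \<in> root_space H \<alpha>"
    "D h = (\<Sum>\<alpha>\<in>insert 0 \<Psi>. v \<alpha>)"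
    using graded_decomposition[OF roots almost_inner_mem[OF D hg(1)]] by metis
  moreover have "[h0, v \<alpha>]\<^sub>L = \<alpha> h0 *s v \<alpha>" if "\<alpha> \<in> insert 0 \<Psi>" for \<alpha>
    using v(2)[OF that] h0(1) root_spaceD by blast
  ultimately have "(\<Sum>\<alpha>\<in>insert 0 \<Psi>. \<alpha> h0 *s v \<alpha>) = 0"
    by (simp add: bracket_sum_right del: sum.insert)
  then have "\<alpha> h0 *s v \<alpha> = 0" if "\<alpha> \<in> insert 0 \<Psi>" for \<alpha>
    using that v(2) finite_Psi Psi_outside
    by (intro weight_sum_eq_0[of "insert 0 \<Psi>" "\<lambda>\<alpha>. \<alpha> h0 *s v \<alpha>" H])
      (auto intro!: subspace_scale[OF subspace_root_space])
  then have "v \<alpha> = 0" if "\<alpha> \<in> \<Psi>" for \<alpha>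
    using h0(2) that by fastforce
  moreover have "0 \<notin> \<Psi>"
    using roots zero_not_root by blast
  ultimately have "D h = v 0"
    using v(3) finite_Psi by simp
  then have Dh: "D h \<in> root_space H 0"
    using v(1) torus_weight_0 by simp
  obtain y where y: "y \<in> graded \<Psi>" "D h = [h, y]\<^sub>L"
    using almost_innerD(4)[OF D hg(1)] by blast
  obtain w where w: "\<And>\<alpha>. \<alpha> \<in> insert 0 \<Psi> \<Longrightarrow> w \<alpha> \<in> root_space H \<alpha>" "y = (\<Sum>\<alpha>\<in>insert 0 \<Psi>. w \<alpha>)"
    using graded_decomposition[OF roots y(1)] by metis
  have "[h, w \<alpha>]\<^sub>L = \<alpha> h *s w \<alpha>" if "\<alpha> \<in> insert 0 \<Psi>" for \<alpha>
    using w(1)[OF that] h root_spaceD by blast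
  then have eq: "D h = (\<Sum>\<alpha>\<in>insert 0 \<Psi>. \<alpha> h *s w \<alpha>)"
    by (simp add: y(2) w(2) bracket_sum_right del: sum.insert)
  also have "\<dots> = (if 0 \<in> insert 0 \<Psi> then (0::'l \<Rightarrow> 'k) h *s w 0 else 0)"
    using w(1) finite_Psi Psi_outside Dh[unfolded eq]
    by (intro weight_sum_component[of "insert 0 \<Psi>" "\<lambda>\<alpha>. \<alpha> h *s w \<alpha>" H])
      (auto intro!: subspace_scale[OF subspace_root_space])
  finally show ?thesis
    by simp
qed

text \<open>As \<open>D\<close> kills \<open>H\<close>, it preserves weights, so in
  \<open>D x = [x, y]\<close> only the component \<open>w 0\<close> of \<open>y\<close> survives,
  and it lies in \<open>H\<close>. The resulting scalar \<open>- \<alpha> (w 0)\<close> may still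
  depend on \<open>x\<close>.\<close>

lemma almost_inner_root_vector:
  assumes D: "almost_inner D" and DH: "\<And>h. h \<in> H \<Longrightarrow> D h = 0"
    and \<alpha>: "\<alpha> \<in> \<Psi>" and x: "x \<in> root_space H \<alpha>"
  obtains c where "D x = c *s x"
proof -
  have xg: "x \<in> graded \<Psi>"
    using \<alpha> x root_space_subset_graded by blast
  have Dx: "D x \<in> root_space H \<alpha>"
    unfolding root_space_def
  proof (intro CollectI ballI)
    fix h assume h: "h \<in> H"
    then have "D [h, x]\<^sub>L = [h, D x]\<^sub>L"
      using almost_innerD(3)[OF D subsetD[OF torus_subset_graded] xg] DH by simp
    then show "[h, D x]\<^sub>L = \<alpha> h *s D x"
      using root_spaceD[OF x h] almost_innerD(2)[OF D xg] by metis
  qed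
  obtain y where y: "y \<in> graded \<Psi>" "D x = [x, y]\<^sub>L"
    using almost_innerD(4)[OF D xg] by blast
  obtain w where w: "w 0 \<in> H" "\<And>\<beta>. \<beta> \<in> insert 0 \<Psi> \<Longrightarrow> w \<beta> \<in> root_space H \<beta>"
    "y = (\<Sum>\<beta>\<in>insert 0 \<Psi>. w \<beta>)"
    using graded_decomposition[OF roots y(1)] by metis
  define A where "A = (+) \<alpha> ` insert 0 \<Psi>"
  define v where "v \<gamma> = [x, w (\<gamma> - \<alpha>)]\<^sub>L" for \<gamma>
  have "(\<Sum>\<gamma>\<in>A. v \<gamma>) = (\<Sum>\<beta>\<in>insert 0 \<Psi>. [x, w \<beta>]\<^sub>L)"
    unfolding A_def v_def by (subst sum.reindex) (simp_all del: sum.insert add: inj_on_def)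
  then have eq: "D x = (\<Sum>\<gamma>\<in>A. v \<gamma>)"
    by (simp add: y(2) w(3) bracket_sum_right del: sum.insert)
  also have "\<dots> = (if \<alpha> \<in> A then v \<alpha> else 0)"
  proof (rule weight_sum_component[where H = H])
    show "finite A"
      using finite_Psi by (simp add: A_def)
    show "v \<gamma> \<in> root_space H \<gamma>" if "\<gamma> \<in> A" for \<gamma>
    proof -
      obtain \<beta> where \<beta>: "\<gamma> = \<alpha> + \<beta>" "\<beta> \<in> insert 0 \<Psi>"
        using \<open>\<gamma> \<in> A\<close> unfolding A_def by blast
      then show ?thesis
        using root_space_bracket[OF x w(2)[OF \<beta>(2)]] by (simp add: v_def)
    qed
    show "\<gamma> h = 0" if "\<gamma> \<in> insert \<alpha> A" "h \<notin> H" for \<gamma> h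
      using that Psi_outside[OF \<alpha>] Psi_outside by (auto simp: A_def)
    show "(\<Sum>\<gamma>\<in>A. v \<gamma>) \<in> root_space H \<alpha>"
      using Dx eq by simp
  qed
  also have "\<dots> = [x, w 0]\<^sub>L"
    by (simp add: A_def v_def)
  also have "\<dots> = (- \<alpha> (w 0)) *s x"
    using root_spaceD[OF x w(1)] by (simp add: bracket_antisym[of x])
  finally show ?thesis
    by (rule that)
qed

text \<open>A linear map for which every vector is an eigenvector is a scalar: compare the scalars
  of \<open>z\<close> and \<open>x + z\<close>. One nonzero vector in the kernel therefore forces
  the whole root space into it.\<close>

lemma almost_inner_vanishes_root_space:
  assumes D: "almost_inner D" and DH: "\<And>h. h \<in> H \<Longrightarrow> D h = 0"
    and \<alpha>: "\<alpha> \<in> \<Psi>" and x: "x \<in> root_space H \<alpha>" "x \<noteq> 0" "D x = 0" and z: "z \<in> root_space H \<alpha>"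
  shows "D z = 0"
proof -
  have g: "x \<in> graded \<Psi>" "z \<in> graded \<Psi>"
    using \<alpha> x z root_space_subset_graded by blast+
  obtain c where c: "D z = c *s z"
    using almost_inner_root_vector[OF D DH \<alpha> z] by metis
  obtain d where d: "D (x + z) = d *s (x + z)"
    using almost_inner_root_vector[OF D DH \<alpha> subspace_add[OF subspace_root_space x(1) z]] by metis
  have eq: "d *s x = (c - d) *s z"
    using almost_innerD(1)[OF D g] c d x(3)
    by (simp add: scale_right_distrib scale_left_diff_distrib algebra_simps)
  show ?thesis
  proof (cases "d = 0")
    case True
    then show ?thesis
      using eq c by simp
  next
    case False
    have "(c - d) *s D z = D (d *s x)"
      using almost_innerD(2)[OF D g(2)] eq by metis
    also have "\<dots> = 0"
      using almost_innerD(2)[OF D g(1)] x(3) by simp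
    finally show ?thesis
      using eq x(2) False by auto
  qed
qed

text \<open>Finitely many hyperplanes do not cover a space over an infinite field: move from
  \<open>h\<close> along a line on which \<open>\<beta>\<close> is not constant.\<close>

lemma regular_element:
  assumes "finite A" "A \<subseteq> roots H"
  shows "\<exists>h\<in>H. \<forall>\<alpha>\<in>A. \<alpha> h \<noteq> 0"
  using assms
proof (induction A rule: finite_induct)
  case empty
  then show ?case
    using subspace_0[OF subspace_torus] by blast
next
  case (insert \<beta> A)
  then obtain h where h: "h \<in> H" "\<And>\<alpha>. \<alpha> \<in> A \<Longrightarrow> \<alpha> h \<noteq> 0"
    by blast
  have "\<beta> \<in> roots H"
    using insert.prems by blast
  then obtain u where u: "u \<in> H" "\<beta> u \<noteq> 0"
    by (rule root_nonzero)
  \<comment> \<open>The parameters at which a root vanishes on the line. If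
    \<open>\<alpha> u = 0\<close>, the quotient is 0 by convention, and \<open>\<alpha>\<close>
    keeps the nonzero value \<open>\<alpha> h\<close> along the line.\<close>
  have "finite ((\<lambda>\<alpha>. - \<alpha> h / \<alpha> u) ` insert \<beta> A)"
    using insert.hyps(1) by simp
  from ex_new_if_finite[OF infinite_UNIV_char_0 this]
  obtain t where t: "t \<notin> (\<lambda>\<alpha>. - \<alpha> h / \<alpha> u) ` insert \<beta> A"
    by (rule exE)
  have "\<alpha> (h + t *s u) \<noteq> 0" if \<alpha>: "\<alpha> \<in> insert \<beta> A" for \<alpha>
  proof
    have "\<alpha> \<in> roots H"
      using \<alpha> insert.prems by blast
    then have "\<alpha> (h + t *s u) = \<alpha> h + t * \<alpha> u"
      using h(1) u(1) subspace_scale[OF subspace_torus]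
      by (simp add: roots_def dual_space_def linear_maps_on_def)
    moreover assume "\<alpha> (h + t *s u) = 0"
    ultimately have *: "t * \<alpha> u = - \<alpha> h"
      by (simp add: eq_neg_iff_add_eq_0 add.commute)
    show False
    proof (cases "\<alpha> u = 0")
      case True
      then show False
        using * h(2) u(2) \<alpha> by auto
    next
      case False
      then have "t = - \<alpha> h / \<alpha> u"
        using * by (simp add: field_simps)
      then show False
        using t \<alpha> by blast
    qed
  qed
  moreover have "h + t *s u \<in> H"
    using h(1) u(1) subspace_torus by (intro subspace_add subspace_scale)
  ultimately show ?case
    by blast
qed

text \<open>
  After normalization on \<open>H\<close>, \<open>D\<close> acts on each root space by a scalar. Applying \<open>D\<close> to one sum of
  root vectors outside \<open>[N, N]\<close> and comparing weight components modulo \<open>[N, N]\<close> shows that a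
  single element \<open>k\<close> of \<open>H\<close> corrects all of these scalars at once.
\<close>

lemma almost_inner_imp_inner:
  assumes D: "almost_inner D"
  shows "\<exists>z\<in>graded \<Psi>. \<forall>x\<in>graded \<Psi>. D x = [z, x]\<^sub>L"
proof -
  obtain h0 where h0: "h0 \<in> H" "\<And>\<alpha>. \<alpha> \<in> \<Psi> \<Longrightarrow> \<alpha> h0 \<noteq> 0"
    using regular_element[OF finite_Psi roots] by blast
  obtain y0 where y0: "y0 \<in> graded \<Psi>" "D h0 = [h0, y0]\<^sub>L"
    using almost_innerD(4)[OF D] h0(1) torus_subset_graded by blast
  \<comment> \<open>Adding \<open>ad y0\<close> cancels \<open>D h0\<close>; by regularity of
    \<open>h0\<close> the new derivation then vanishes on all of \<open>H\<close>.\<close>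
  define D1 where "D1 x = D x + [y0, x]\<^sub>L" for x
  have D1: "almost_inner D1"
    unfolding D1_def using D y0(1) by (rule almost_inner_add_inner)
  have "D1 h0 = 0"
    by (simp add: D1_def y0(2) bracket_antisym[of y0])
  then have D1H: "D1 h = 0" if "h \<in> H" for h
    using almost_inner_vanishes_torus[where D = D1 and ?h0.0 = h0] D1 h0 that by blast
  define N2 where "N2 = span {[x, y]\<^sub>L | x y. x \<in> N \<and> y \<in> N}"
  have N2: "subspace N2" "\<And>x y. x \<in> N \<Longrightarrow> y \<in> N \<Longrightarrow> [x, y]\<^sub>L \<in> N2"
    by (auto simp: N2_def intro: span_base)
  have N2H: "[h, u]\<^sub>L \<in> N2" if "h \<in> H" "u \<in> N2" for h u
  proof -
    have "[h, [x, y]\<^sub>L]\<^sub>L \<in> N2" if "x \<in> N" "y \<in> N" for x y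
      unfolding bracket_leibniz[of h] using that \<open>h \<in> H\<close> N2 stable_subalgebra_N
      by (intro subspace_add) (auto simp: stable_subalgebra_def)
    then have "span {[x, y]\<^sub>L | x y. x \<in> N \<and> y \<in> N} \<subseteq> {u. [h, u]\<^sub>L \<in> N2}"
      using N2(1) by (intro span_minimal subspace_bracket_vimage_right) auto
    then show ?thesis
      using that by (auto simp: N2_def)
  qed
  define \<Pi> where "\<Pi> = {\<alpha> \<in> \<Psi>. \<not> root_space H \<alpha> \<subseteq> N2}"
  have "\<forall>\<alpha>\<in>\<Pi>. \<exists>x. x \<in> root_space H \<alpha> \<and> x \<notin> N2"
    by (auto simp: \<Pi>_def)
  from bchoice[OF this] obtain e
    where e: "\<And>\<alpha>. \<alpha> \<in> \<Pi> \<Longrightarrow> e \<alpha> \<in> root_space H \<alpha>" "\<And>\<alpha>. \<alpha> \<in> \<Pi> \<Longrightarrow> e \<alpha> \<notin> N2"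
    by blast
  have \<Pi>: "\<Pi> \<subseteq> \<Psi>" "finite \<Pi>"
    using finite_Psi by (auto simp: \<Pi>_def)
  have eN: "e \<alpha> \<in> N" if "\<alpha> \<in> \<Pi>" for \<alpha>
    using e(1)[OF that] that \<Pi> root_space_subset_N by blast
  define X where "X = (\<Sum>\<alpha>\<in>\<Pi>. e \<alpha>)"
  have X: "X \<in> N"
    unfolding X_def using eN by (intro subspace_sum[OF subspace_N])
  obtain y where y: "y \<in> graded \<Psi>" "D1 X = [X, y]\<^sub>L"
    using almost_innerD(4)[OF D1] X N_subset_graded by blast
  obtain k n where kn: "k \<in> H" "n \<in> N" "y = k + n"
    using graded_split[OF y(1)] by metis
  \<comment> \<open>Adding \<open>ad k\<close> cancels the part \<open>[X, k]\<close> of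
    \<open>[X, k + n]\<close>; what remains is \<open>[X, n]\<close>, an element of
    \<open>N2\<close>.\<close>
  define D2 where "D2 x = D1 x + [k, x]\<^sub>L" for x
  have kg: "k \<in> graded \<Psi>"
    using kn(1) torus_subset_graded by blast
  have D2: "almost_inner D2"
    unfolding D2_def using D1 kg by (rule almost_inner_add_inner)
  have D2H: "D2 h = 0" if "h \<in> H" for h
    using that kn(1) by (simp add: D2_def D1H torus_bracket)
  have "D2 X = [X, n]\<^sub>L"
    by (simp add: D2_def y(2) kn(3) bracket_add_right bracket_antisym[of k])
  moreover have "D2 X = (\<Sum>\<alpha>\<in>\<Pi>. D2 (e \<alpha>))"
    unfolding X_def using eN N_subset_graded by (intro almost_inner_sum[OF D2]) blast
  ultimately have sum: "(\<Sum>\<alpha>\<in>\<Pi>. D2 (e \<alpha>)) \<in> N2"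
    using N2(2)[OF X kn(2)] by simp
  have D2e: "D2 (e \<alpha>) = 0" if \<alpha>: "\<alpha> \<in> \<Pi>" for \<alpha>
  proof -
    have scalar: "\<exists>c. D2 (e \<beta>) = c *s e \<beta>" if "\<beta> \<in> \<Pi>" for \<beta>
      using almost_inner_root_vector[OF D2 D2H _ e(1)[OF that]] that \<Pi>(1) by blast
    have "D2 (e \<beta>) \<in> root_space H \<beta>" if "\<beta> \<in> \<Pi>" for \<beta>
      using scalar[OF that] e(1)[OF that] subspace_scale[OF subspace_root_space] by metis
    then have "D2 (e \<alpha>) \<in> N2"
      using \<Pi> Psi_outside sum \<alpha>
      by (intro weight_component_mem[where v = "\<lambda>\<alpha>. D2 (e \<alpha>)" and H = H, OF \<Pi>(2) N2(1) N2H]) auto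
    moreover obtain c where c: "D2 (e \<alpha>) = c *s e \<alpha>"
      using scalar[OF \<alpha>] by blast
    \<comment> \<open>A nonzero \<open>c\<close> could be divided out, putting
      \<open>e \<alpha>\<close> into \<open>N2\<close> against its choice.\<close>
    ultimately have "inverse c *s c *s e \<alpha> \<in> N2"
      using subspace_scale[OF N2(1)] by metis
    then show ?thesis
      using e(2)[OF \<alpha>] c by (cases "c = 0") auto
  qed
  have ker: "D2 z = 0" if "\<alpha> \<in> \<Pi>" "z \<in> root_space H \<alpha>" for \<alpha> z
  proof (rule almost_inner_vanishes_root_space[OF D2 D2H _ e(1)[OF that(1)] _ D2e[OF that(1)] that(2)])
    show "\<alpha> \<in> \<Psi>"
      using that(1) \<Pi>(1) by blast
    show "e \<alpha> \<noteq> 0"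
      using e(2)[OF that(1)] subspace_0[OF N2(1)] by metis
  qed
  \<comment> \<open>This kernel is a subalgebra because \<open>D2\<close> is a derivation, and
    \<open>H\<close>-stable because \<open>D2\<close> kills \<open>H\<close>; so
    \<open>stable_subalgebra_generates\<close> can be applied to it.\<close>
  define K where "K = {x \<in> N. D2 x = 0}"
  have Kg: "x \<in> graded \<Psi>" if "x \<in> K" for x
    using that N_subset_graded by (auto simp: K_def)
  have "stable_subalgebra K"
    unfolding stable_subalgebra_def
  proof (intro conjI ballI)
    show "subspace K"
      unfolding subspace_def
    proof (intro conjI ballI allI)
      show "0 \<in> K"
        using almost_inner_0[OF D2] subspace_0[OF subspace_N] by (simp add: K_def)
      show "x + y \<in> K" if "x \<in> K" "y \<in> K" for x y
        using that almost_innerD(1)[OF D2 Kg Kg] subspace_add[OF subspace_N] by (simp add: K_def)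
      show "c *s x \<in> K" if "x \<in> K" for c x
        using that almost_innerD(2)[OF D2 Kg] subspace_scale[OF subspace_N] by (simp add: K_def)
    qed
    show "[x, y]\<^sub>L \<in> K" if "x \<in> K" "y \<in> K" for x y
      using that almost_innerD(3)[OF D2 Kg Kg, of x y] stable_subalgebra_N
      by (simp add: K_def stable_subalgebra_def)
    show "[h, x]\<^sub>L \<in> K" if "h \<in> H" "x \<in> K" for h x
      using that almost_innerD(3)[OF D2 subsetD[OF torus_subset_graded] Kg, of h x] D2H[of h]
        stable_subalgebra_N
      by (simp add: K_def stable_subalgebra_def)
  qed (auto simp: K_def)
  moreover have "root_space H \<alpha> \<subseteq> K \<or> root_space H \<alpha> \<subseteq> N2" if "\<alpha> \<in> \<Psi>" for \<alpha>
    using that ker root_space_subset_N by (auto simp: K_def \<Pi>_def)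
  ultimately have "K = N"
    unfolding N2_def by (rule stable_subalgebra_generates)
  then have D2N: "D2 n = 0" if "n \<in> N" for n
    using that by (auto simp: K_def)
  have "D x = [- (y0 + k), x]\<^sub>L" if x: "x \<in> graded \<Psi>" for x
  proof -
    obtain h n where hn: "h \<in> H" "n \<in> N" "x = h + n"
      using graded_split[OF x] by metis
    then have "D2 x = 0"
      using almost_innerD(1)[OF D2, of h n] torus_subset_graded N_subset_graded D2H D2N by auto
    then show ?thesis
      unfolding bracket_minus_left bracket_add_left eq_neg_iff_add_eq_0
      by (simp add: D2_def D1_def add.assoc)
  qed
  moreover have "- (y0 + k) \<in> graded \<Psi>"
    using y0(1) kg subspace_graded by (intro subspace_neg subspace_add)
  ultimately show ?thesis
    by blast
qed

end

section \<open>Passage from a minimal subalgebra of a semisimple algebra to the locales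
  above\<close>

theorem theorem3p5:
  fixes scale :: "'k::{alg_closed_field, field_char_0} \<Rightarrow> 'l::ab_group_add \<Rightarrow> 'l"
    and bracket :: "'l \<Rightarrow> 'l \<Rightarrow> 'l"
    and Basis H L :: "'l set"
  assumes "finite_dimensional_lie_algebra scale bracket Basis"
    and "lie_algebra.semisimple scale bracket"
    and "lie_algebra.maximal_torus scale bracket H"
    and "lie_algebra.minimal_Q_graded_subalgebra scale bracket H L"
  shows "lie_algebra.AID scale bracket L = lie_algebra.Inn bracket L"
proof -
  interpret finite_dimensional_lie_algebra scale bracket Basis
    by (rule assms(1))
  \<comment> \<open>The center is an abelian ideal, hence solvable, so semisimplicity makes it
    zero.\<close>
  have center: "x = 0" if "\<And>y. [x, y]\<^sub>L = 0" for x
  proof -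
    let ?Z = "{x. \<forall>y. [x, y]\<^sub>L = 0}"
    have "[x, y]\<^sub>L = 0" if "y \<in> ?Z" for x y
      using that bracket_antisym[of x y] by simp
    then have "lie_ideal ?Z"
      by (auto simp: lie_ideal_def subspace_def bracket_add_left bracket_scale_left)
    moreover have "solvable ?Z"
    proof -
      have "{[x, y]\<^sub>L | x y. x \<in> ?Z \<and> y \<in> ?Z} = {0}"
        by (auto intro!: exI[of _ 0])
      then have "derived_series ?Z 1 = {0}"
        by simp
      then show ?thesis
        unfolding solvable_def by blast
    qed
    ultimately have "?Z = {0}"
      using assms(2) by (simp add: semisimple_def)
    then show ?thesis
      using that by blast
  qed
  interpret faithful_torus scale bracket Basis H
    using assms(3) center by unfold_locales (auto simp: maximal_torus_def)
  obtain \<Psi> where \<Psi>: "\<Psi> \<subseteq> roots H" "L = graded \<Psi>" "subalgebra L" "root_lattice H = int_span \<Psi>"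
    using assms(4) unfolding minimal_Q_graded_subalgebra_def Q_graded_subalgebra_graded by blast
  interpret root_nilradical scale bracket Basis H \<Psi>
  proof
    show "\<Psi> \<subseteq> roots H" "subalgebra (graded \<Psi>)"
      using \<Psi> by simp_all
    show "[e, f]\<^sub>L = 0" if "\<alpha> \<in> \<Psi>" "- \<alpha> \<in> \<Psi>" "e \<in> root_space H \<alpha>" "f \<in> root_space H (- \<alpha>)" for \<alpha> e f
      using minimal_bracket_opposite[OF assms(4)[unfolded \<Psi>(2)] \<Psi>(1,4) that] .
  qed
  show ?thesis
  proof
    show "AID L \<subseteq> Inn L"
    proof
      fix D assume D: "D \<in> AID L"
      then have "almost_inner D"
        unfolding AID_def derivations_def linear_maps_on_def almost_inner_def \<Psi>(2) by blast
      then obtain z where z: "z \<in> L" "\<And>x. x \<in> L \<Longrightarrow> D x = [z, x]\<^sub>L"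
        using almost_inner_imp_inner unfolding \<Psi>(2) by blast
      moreover have "D x = 0" if "x \<notin> L" for x
        using D that by (simp add: AID_def derivations_def linear_maps_on_def)
      ultimately have "D = (\<lambda>x. if x \<in> L then [z, x]\<^sub>L else 0)"
        by auto
      then show "D \<in> Inn L"
        using z(1) unfolding Inn_def by blast
    qed
    show "Inn L \<subseteq> AID L"
    proof
      fix D assume "D \<in> Inn L"
      then obtain z where z: "z \<in> L" "D = (\<lambda>x. if x \<in> L then [z, x]\<^sub>L else 0)"
        unfolding Inn_def by blast
      have L: "subspace L" "\<And>x y. x \<in> L \<Longrightarrow> y \<in> L \<Longrightarrow> [x, y]\<^sub>L \<in> L"
        using \<Psi>(3) by (simp_all add: subalgebra_def)
      have "D \<in> derivations L"
        unfolding derivations_def linear_maps_on_def z(2) using z(1) L bracket_leibniz[of z]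
        by (auto simp: subspace_add subspace_scale bracket_add_right bracket_scale_right)
      \<comment> \<open>Since \<open>[z, x] = [x, - z]\<close>, the element \<open>- z\<close> is a
        witness for every \<open>x\<close>.\<close>
      moreover have "\<exists>y. D x = [x, y]\<^sub>L \<and> y \<in> L" if "x \<in> L" for x
        using that z L bracket_minus_right[of x z] bracket_antisym[of z x] subspace_neg[OF L(1) z(1)]
        by (intro exI[of _ "- z"]) simp
      ultimately show "D \<in> AID L"
        unfolding AID_def by blast
    qed
  qed
qed

end
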